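(* Let $i,j$ be real numbers with $0<i,j<1$ and $i+j=1$. Then for every $\boldsymbol\theta=(\gamma,\delta)\in\mathbb{R}^2$, the set $\mathrm{Bad}_{\boldsymbol\theta}(i,j)$ is a $(30\sqrt{2})^{-1}$-winning subset of $\mathbb{R}^2$.
   Context: For $t\in\mathbb{R}$, $\|t\|$ denotes the distance from $t$ to the nearest integer. For $\boldsymbol\theta=(\gamma,\delta)\in\mathbb{R}^2$, $\mathrm{Bad}_{\boldsymbol\theta}(i,j)$ is the set of $(x,y)\in\mathbb{R}^2$ for which there is a constant $c(x,y)>0$ with $\max\{\|qx-\gamma\|^{1/i},\|qy-\delta\|^{1/j}\}>c(x,y)\,q^{-1}$ for all $q\in\mathbb{N}$. Schmidt's $(\alpha,\beta)$-game in $\mathbb{R}^m$: for $0<\alpha,\beta<1$, player B chooses a closed (Euclidean) ball $B_0\subset\mathbb{R}^m$; then A chooses a closed ball $A_0\subset B_0$ of diameter $\alpha\rho(B_0)$; then B chooses a closed ball $B_1\subset A_0$ of diameter $\beta\rho(A_0)$, and so on alternately, yielding nested balls $B_0\supset A_0\supset B_1\supset A_1\supset\cdots$ with $\rho(B_n)=(\alpha\beta)^n\rho(B_0)$ and $\rho(A_n)=\alpha\rho(B_n)$ ($\rho$ = diameter). A set $X\subset\mathbb{R}^m$ is $(\alpha,\beta)$-winning if A can play so that the unique point of $\bigcap_n B_n$ lies in $X$ regardless of how B plays, and $\alpha$-winning if it is $(\alpha,\beta)$-winning for every $\beta\in(0,1)$. *)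

theory Defs
  imports "HOL-Analysis.Analysis"
begin

definition dist_nearest_int :: "real \<Rightarrow> real" where
  "dist_nearest_int t = infdist t \<int>"

definition Bad :: "real \<times> real \<Rightarrow> real \<Rightarrow> real \<Rightarrow> (real \<times> real) set" where
  "Bad \<theta> i j = {(x, y). \<exists>c>0. \<forall>q::nat. q \<ge> 1 \<longrightarrow>
     max (dist_nearest_int (real q * x - fst \<theta>) powr (1 / i))
         (dist_nearest_int (real q * y - snd \<theta>) powr (1 / j)) > c * inverse (real q)}"

definition closed_ball :: "'a::euclidean_space set \<Rightarrow> bool" where
  "closed_ball S \<longleftrightarrow> (\<exists>x r. r > 0 \<and> S = cball x r)"

text \<open>A strategy \<open>\<sigma>\<close> for player A maps the list \<open>[B\<^sub>0, \<dots>, B\<^sub>n]\<close> of all balls chosen so far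
  by player B to A's answer \<open>A\<^sub>n\<close>.\<close>

definition A_ball :: "('a set list \<Rightarrow> 'a set) \<Rightarrow> (nat \<Rightarrow> 'a set) \<Rightarrow> nat \<Rightarrow> 'a set" where
  "A_ball \<sigma> B n = \<sigma> (map B [0..<Suc n])"

definition legal_A ::
  "real \<Rightarrow> ('a::euclidean_space set list \<Rightarrow> 'a set) \<Rightarrow> (nat \<Rightarrow> 'a set) \<Rightarrow> nat \<Rightarrow> bool" where
  "legal_A \<alpha> \<sigma> B n \<longleftrightarrow>
     closed_ball (A_ball \<sigma> B n) \<and> A_ball \<sigma> B n \<subseteq> B n \<and>
     diameter (A_ball \<sigma> B n) = \<alpha> * diameter (B n)"

fun legal_B ::
  "real \<Rightarrow> ('a::euclidean_space set list \<Rightarrow> 'a set) \<Rightarrow> (nat \<Rightarrow> 'a set) \<Rightarrow> nat \<Rightarrow> bool" where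
  "legal_B \<beta> \<sigma> B 0 \<longleftrightarrow> closed_ball (B 0)"
| "legal_B \<beta> \<sigma> B (Suc n) \<longleftrightarrow>
     closed_ball (B (Suc n)) \<and> B (Suc n) \<subseteq> A_ball \<sigma> B n \<and>
     diameter (B (Suc n)) = \<beta> * diameter (A_ball \<sigma> B n)"

text \<open>A must answer legally for as long as B has played legally, even if B's play is not
  continued; otherwise A could win vacuously by a move after which B has no legal move.\<close>

definition schmidt_winning :: "real \<Rightarrow> real \<Rightarrow> 'a::euclidean_space set \<Rightarrow> bool" where
  "schmidt_winning \<alpha> \<beta> X \<longleftrightarrow>
     (\<exists>\<sigma>. \<forall>B.
        (\<forall>n. (\<forall>k\<le>n. legal_B \<beta> \<sigma> B k) \<longrightarrow> legal_A \<alpha> \<sigma> B n) \<and>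
        ((\<forall>n. legal_B \<beta> \<sigma> B n) \<longrightarrow> (\<exists>x\<in>X. (\<Inter>n. B n) = {x})))"

definition alpha_winning :: "real \<Rightarrow> 'a::euclidean_space set \<Rightarrow> bool" where
  "alpha_winning \<alpha> X \<longleftrightarrow> (\<forall>\<beta>. 0 < \<beta> \<and> \<beta> < 1 \<longrightarrow> schmidt_winning \<alpha> \<beta> X)"

end

theory Submission
  imports Defs
begin

text \<open>
  Let \<open>R = 1 / (\<alpha> \<beta>)\<close>. If at stage \<open>n\<close> one line is prescribed for every \<open>k \<le> n + 1\<close>, then A can
  steer the outcome away from the strips of half-width about \<open>r\<^sub>n R\<^sup>-\<^sup>k\<close> around all of
  these lines: among three small balls inside \<open>B\<^sub>n\<close> whose centres form a right-angled triangle a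
  thin strip meets at most two, so A can reduce a weighted count of the dangerous strips by the
  factor \<open>2/3\<close> at each move, and weights growing by \<open>5/4\<close> per move keep the count below one.

  To a rational point \<open>(p/q, r/q)\<close> attach an integer line \<open>A x + B y + C = 0\<close> through it with
  \<open>\<bar>A\<bar> \<le> q\<^sup>i\<close>, \<open>\<bar>B\<bar> \<le> q\<^sup>j\<close> (J. An). The box of points badly close to \<open>(p/q, r/q)\<close> lies in a
  strip of width about \<open>1/H\<close>, \<open>H = q max \<bar>A\<bar> \<bar>B\<bar>\<close>, around this line. Sort the points by \<open>H\<close> and by
  \<open>k\<close>, the logarithmic size of \<open>q\<^bsup>1 + max i j\<^esup> / H\<close>. Suppose the outcome \<open>X\<close> of the game is badly
  close to a rational point, and take one with the least \<open>q\<close>. Two points of the same class whose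
  boxes meet \<open>B\<^sub>n\<close> have the same line: if \<open>k\<close> is small each point lies on the line of the other
  since an integer less than one in modulus vanishes, and if \<open>k\<close> is large the intersection of two
  different lines would be a rational point with a smaller denominator that \<open>X\<close> is badly close to.
  So A has avoided the strip, a contradiction.

  Hence \<open>X\<close> is homogeneously badly approximable. Taking differences of two inhomogeneous
  solutions then shows that at each scale at most one box matters for \<open>B\<^sub>n\<close>, and this box costs
  only one further strip per stage.
\<close>

subsection \<open>Avoiding strips\<close>

text \<open>Normalising by the larger coefficient makes the strip independent of the scaling of the
  line; the true half-width is \<open>d\<close> up to a factor between 1 / sqrt 2 and 1. A
  degenerate triple with \<open>a = b = 0\<close> gives the empty set, so any triple may be
  prescribed as a line.\<close>

definition strip :: "real \<times> real \<times> real \<Rightarrow> real \<Rightarrow> (real \<times> real) set" where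
  "strip L d = (case L of (a, b, c) \<Rightarrow>
     {(x, y). \<bar>a * x + b * y + c\<bar> < d * max \<bar>a\<bar> \<bar>b\<bar>})"

definition radius :: "'a::metric_space set \<Rightarrow> real" where
  "radius b = diameter b / 2"

definition centre :: "'a::metric_space set \<Rightarrow> 'a" where
  "centre b = (SOME z. b = cball z (radius b))"

lemma closed_ball_eq_cball:
  fixes b :: "'a::euclidean_space set"
  assumes "closed_ball b"
  shows "b = cball (centre b) (radius b)" "radius b > 0"
proof -
  obtain z r where zr: "r > 0" "b = cball z r"
    using assms unfolding closed_ball_def by auto
  then have r: "radius b = r" by (simp add: radius_def)
  then show "radius b > 0" using zr by simp
  show "b = cball (centre b) (radius b)"
    unfolding centre_def by (rule someI[of _ z]) (use zr r in simp)
qed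

text \<open>The right-angled triangle of candidate centres, in units of the radius. Its legs lie
  along the axes, so that comparing values along them isolates each coefficient of a line.\<close>

definition offset :: "nat \<Rightarrow> real \<times> real" where
  "offset l = (if l = 0 then (0, 0) else if l = 1 then (1/2, 0) else (0, 1/2))"

definition option_ball :: "real \<Rightarrow> (real \<times> real) set \<Rightarrow> nat \<Rightarrow> (real \<times> real) set" where
  "option_ball \<alpha> b l = cball (centre b + radius b *\<^sub>R offset l) (\<alpha> * radius b)"

lemma norm_offset: "norm (offset l) \<le> 1/2"
  by (simp add: offset_def norm_Pair)

lemma option_ball_subset:
  assumes "closed_ball b" "\<alpha> \<le> 1/2"
  shows "option_ball \<alpha> b l \<subseteq> b"
proof -
  note b = closed_ball_eq_cball[OF assms(1)]
  have "option_ball \<alpha> b l \<subseteq> cball (centre b) (radius b)"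
  proof
    fix x assume "x \<in> option_ball \<alpha> b l"
    then have "dist (centre b + radius b *\<^sub>R offset l) x \<le> \<alpha> * radius b"
      by (simp add: option_ball_def)
    moreover have "dist (centre b) (centre b + radius b *\<^sub>R offset l) \<le> radius b * (1/2)"
      using mult_left_mono[OF norm_offset[of l], of "radius b"] b(2) by (simp add: dist_norm)
    moreover have "\<alpha> * radius b \<le> 1/2 * radius b"
      using mult_right_mono[OF assms(2), of "radius b"] b(2) by simp
    ultimately have "dist (centre b) x \<le> radius b"
      using dist_triangle[of "centre b" x "centre b + radius b *\<^sub>R offset l"] by linarith
    then show "x \<in> cball (centre b) (radius b)" by simp
  qed
  then show ?thesis using b(1) by simp
qed

lemma strip_meets_ball:
  assumes "strip (a, b, c) d \<inter> cball (u, v) \<rho> \<noteq> {}"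
  shows "\<bar>a * u + b * v + c\<bar> < (d + 2 * \<rho>) * max \<bar>a\<bar> \<bar>b\<bar>"
proof -
  obtain x y where xy: "\<bar>a * x + b * y + c\<bar> < d * max \<bar>a\<bar> \<bar>b\<bar>" "dist (u, v) (x, y) \<le> \<rho>"
    using assms by (auto simp: strip_def)
  have "\<bar>u - x\<bar> \<le> \<rho>" "\<bar>v - y\<bar> \<le> \<rho>"
    using dist_fst_le[of "(u, v)" "(x, y)"] dist_snd_le[of "(u, v)" "(x, y)"] xy(2)
    by (auto simp: dist_real_def)
  then have "\<bar>a * (u - x)\<bar> \<le> max \<bar>a\<bar> \<bar>b\<bar> * \<rho>" "\<bar>b * (v - y)\<bar> \<le> max \<bar>a\<bar> \<bar>b\<bar> * \<rho>"
    unfolding abs_mult by (intro mult_mono; simp)+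
  moreover have "a * u + b * v + c = (a * x + b * y + c) + a * (u - x) + b * (v - y)"
    "(d + 2 * \<rho>) * max \<bar>a\<bar> \<bar>b\<bar> = d * max \<bar>a\<bar> \<bar>b\<bar> + 2 * (max \<bar>a\<bar> \<bar>b\<bar> * \<rho>)"
    by (simp_all add: algebra_simps)
  ultimately show ?thesis using xy(1) by linarith
qed

text \<open>A line with small values at all three centres changes little along both legs; these
  changes are half the radius times the two coefficients, so the larger coefficient would be less
  than 2/7 of itself.\<close>

lemma thin_strip_misses_option:
  assumes "closed_ball b" "\<alpha> \<le> 1/42" "d \<le> radius b / 42"
  shows "\<exists>l<3. strip L d \<inter> option_ball \<alpha> b l = {}"
proof (rule ccontr)
  assume "\<not> ?thesis"
  then have ne: "strip L d \<inter> option_ball \<alpha> b l \<noteq> {}" if "l < 3" for l using that by blast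
  obtain u v where uv: "centre b = (u, v)" by fastforce
  obtain p q c where L: "L = (p, q, c)" by (cases L) auto
  define r where "r = radius b"
  define M where "M = max \<bar>p\<bar> \<bar>q\<bar>"
  have r: "r > 0" using closed_ball_eq_cball(2)[OF assms(1)] by (simp add: r_def)
  have "M \<ge> 0" by (simp add: M_def)
  \<comment> \<open>The half-width and twice the option radius add up to at most 1/42 + 2/42 = 1/14
    of \<open>r\<close>.\<close>
  have "\<alpha> * r \<le> 1/42 * r" using assms(2) r by (intro mult_right_mono) auto
  then have "(d + 2 * (\<alpha> * r)) * M \<le> (r / 14) * M"
    using assms(3) \<open>M \<ge> 0\<close> by (intro mult_right_mono) (auto simp: r_def)
  then have bd: "t < (d + 2 * (\<alpha> * r)) * M \<Longrightarrow> t < r * M / 14" for t by simp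
  have "\<bar>p * u + q * v + c\<bar> < r * M / 14"
    using strip_meets_ball[OF ne[of 0, unfolded option_ball_def L uv, simplified offset_def, simplified]] bd
    by (simp add: r_def M_def)
  moreover have "\<bar>p * (u + r / 2) + q * v + c\<bar> < r * M / 14"
    using strip_meets_ball[OF ne[of 1, unfolded option_ball_def L uv, simplified offset_def, simplified]] bd
    by (simp add: r_def M_def)
  moreover have "\<bar>p * u + q * (v + r / 2) + c\<bar> < r * M / 14"
    using strip_meets_ball[OF ne[of 2, unfolded option_ball_def L uv, simplified offset_def, simplified]] bd
    by (simp add: r_def M_def)
  moreover have "p * (u + r / 2) + q * v + c = (p * u + q * v + c) + p * r / 2"
    "p * u + q * (v + r / 2) + c = (p * u + q * v + c) + q * r / 2" by (simp_all add: algebra_simps)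
  ultimately have "\<bar>p * r\<bar> < 2 * (r * M / 7)" "\<bar>q * r\<bar> < 2 * (r * M / 7)" by linarith+
  then have "r * \<bar>p\<bar> < 2/7 * (r * M)" "r * \<bar>q\<bar> < 2/7 * (r * M)"
    using r by (simp_all add: abs_mult mult.commute)
  then have "r * M < 2/7 * (r * M)" unfolding M_def by (auto simp: max_def)
  moreover have "r * M \<ge> 0" using r \<open>M \<ge> 0\<close> by simp
  ultimately show False by linarith
qed

text \<open>The price \<open>(4/5) ^ (n + k + 20)\<close> of a strip exceeds A's budget \<open>30 * (4/5) ^ (m + 20)\<close> from stage
  \<open>m = n + k + 20\<close> on; until then the strip is thin compared with the ball \<open>B m\<close>.\<close>

definition toll :: "real \<Rightarrow> (nat \<Rightarrow> nat \<Rightarrow> (real \<times> real) set \<Rightarrow> real \<times> real \<times> real) \<Rightarrow>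
    (nat \<Rightarrow> (real \<times> real) set) \<Rightarrow> nat \<Rightarrow> (real \<times> real) set \<Rightarrow> real" where
  "toll R S B m T = (\<Sum>(n, k) \<in> Sigma {..m} (\<lambda>n. {..Suc n}).
     if strip (S n k (B n)) (radius (B n) / R ^ (k + 20)) \<inter> T = {} then 0
     else (4/5) ^ (n + k + 20))"

lemma toll_cong:
  assumes "\<And>n. n \<le> m \<Longrightarrow> B n = B' n"
  shows "toll R S B m T = toll R S B' m T"
  unfolding toll_def by (rule sum.cong) (auto simp: assms)

lemma toll_mono:
  assumes "T \<subseteq> T'"
  shows "toll R S B m T \<le> toll R S B m T'"
  unfolding toll_def
proof (rule sum_mono, clarify)
  fix n k
  let ?s = "strip (S n k (B n)) (radius (B n) / R ^ (k + 20))"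
  show "(if ?s \<inter> T = {} then 0 else (4/5) ^ (n + k + 20) :: real)
      \<le> (if ?s \<inter> T' = {} then 0 else (4/5) ^ (n + k + 20))"
    using assms by (cases "?s \<inter> T' = {}") auto
qed

text \<open>Only the strips prescribed at stage \<open>Suc m\<close> are new. Over \<open>k\<close>
  their prices form a geometric series of ratio 4/5, with sum at most 5 times its first
  term.\<close>

lemma toll_Suc:
  "toll R S B (Suc m) T \<le> toll R S B m T + 5 * (4/5) ^ (Suc m + 20)"
proof -
  have eq: "Sigma {..Suc m} (\<lambda>n. {..Suc n})
      = Sigma {..m} (\<lambda>n. {..Suc n}) \<union> Pair (Suc m) ` {..Suc (Suc m)}"
    by (auto simp: le_Suc_eq)
  have "toll R S B (Suc m) T = toll R S B m T + (\<Sum>k \<in> {..Suc (Suc m)}.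
     if strip (S (Suc m) k (B (Suc m))) (radius (B (Suc m)) / R ^ (k + 20)) \<inter> T = {} then 0
     else (4/5) ^ (Suc m + k + 20))"
    unfolding toll_def eq by (subst sum.union_disjoint) (auto simp: sum.reindex inj_on_def)
  also have "\<dots> \<le> toll R S B m T + (\<Sum>k \<in> {..Suc (Suc m)}. (4/5) ^ (Suc m + 20) * (4/5) ^ k)"
    by (intro add_left_mono sum_mono) (auto simp: power_add)
  also have "(\<Sum>k \<in> {..Suc (Suc m)}. (4/5) ^ (Suc m + 20) * (4/5::real) ^ k)
      = (4/5) ^ (Suc m + 20) * (\<Sum>k \<in> {..Suc (Suc m)}. (4/5) ^ k)"
    by (rule sum_distrib_left[symmetric])
  also have "\<dots> \<le> (4/5) ^ (Suc m + 20) * 5"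
    by (intro mult_left_mono) (simp_all add: sum_gp0 del: sum.atMost_Suc)
  finally show ?thesis by simp
qed

lemma toll_0: "toll R S B 0 T \<le> 5 * (4/5) ^ 20"
proof -
  have eq: "Sigma {..0::nat} (\<lambda>n. {..Suc n}) = {(0, 0), (0, 1)}" by (auto simp: le_Suc_eq)
  show ?thesis unfolding toll_def eq by (simp add: power_divide)
qed

section \<open>The greedy strategy\<close>

definition strategy :: "real \<Rightarrow> real \<Rightarrow> (nat \<Rightarrow> nat \<Rightarrow> (real \<times> real) set \<Rightarrow> real \<times> real \<times> real) \<Rightarrow>
    (real \<times> real) set list \<Rightarrow> (real \<times> real) set" where
  "strategy \<alpha> R S bs = option_ball \<alpha> (last bs)
     (ARG_MIN (\<lambda>l. toll R S (\<lambda>n. bs ! n) (length bs - 1) (option_ball \<alpha> (last bs) l)) l. l < 3)"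

lemma A_ball_strategy:
  obtains l where "l < 3" "A_ball (strategy \<alpha> R S) B m = option_ball \<alpha> (B m) l"
    "\<And>l'. l' < 3 \<Longrightarrow> toll R S B m (option_ball \<alpha> (B m) l) \<le> toll R S B m (option_ball \<alpha> (B m) l')"
proof -
  define f where "f = (\<lambda>l. toll R S B m (option_ball \<alpha> (B m) l))"
  define l where "l = (ARG_MIN f l. l < 3)"
  have nth: "map B [0..<Suc m] ! n = B n" if "n \<le> m" for n
    using that by (simp add: nth_append del: upt_Suc)
  have last: "last (map B [0..<Suc m]) = B m" by simp
  have "toll R S (\<lambda>n. map B [0..<Suc m] ! n) m T = toll R S B m T" for T
    by (rule toll_cong) (rule nth)
  then have A: "A_ball (strategy \<alpha> R S) B m = option_ball \<alpha> (B m) l"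
    by (simp add: A_ball_def strategy_def l_def f_def del: upt_Suc) simp
  have "{..<3::nat} \<noteq> {}" by (simp add: lessThan_empty_iff)
  then have "is_arg_min f (\<lambda>l. l < 3) (arg_min_on f {..<3})"
    using arg_min_if_finite[of "{..<3::nat}" f] unfolding is_arg_min_def by blast
  then have "is_arg_min f (\<lambda>l. l < 3) l"
    unfolding l_def arg_min_def by (rule someI)
  then have "l < 3" "\<And>l'. l' < 3 \<Longrightarrow> f l \<le> f l'" by (auto simp: is_arg_min_linorder)
  with A that show ?thesis unfolding f_def by blast
qed

text \<open>Averaging: every strip that meets \<open>B m\<close> misses one of the three options, so
  the tolls of the options add up to at most twice that of \<open>B m\<close>, and the cheapest
  option pays at most a third of this. Strips that have already left \<open>B m\<close> may be
  thick.\<close>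

lemma toll_thin:
  assumes "closed_ball (B m)" "0 < \<alpha>" "\<alpha> \<le> 1/42"
    and thin: "\<And>n k. \<lbrakk>n \<le> m; k \<le> Suc n;
      strip (S n k (B n)) (radius (B n) / R ^ (k + 20)) \<inter> B m \<noteq> {}\<rbrakk> \<Longrightarrow>
      radius (B n) / R ^ (k + 20) \<le> radius (B m) / 42"
  shows "toll R S B m (A_ball (strategy \<alpha> R S) B m) \<le> 2/3 * toll R S B m (B m)"
proof -
  obtain l where l: "l < 3" "A_ball (strategy \<alpha> R S) B m = option_ball \<alpha> (B m) l"
    "\<And>l'. l' < 3 \<Longrightarrow> toll R S B m (option_ball \<alpha> (B m) l) \<le> toll R S B m (option_ball \<alpha> (B m) l')"
    using A_ball_strategy[of \<alpha> R S B m] by metis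
  let ?t = "\<lambda>T. toll R S B m T" and ?o = "option_ball \<alpha> (B m)"
  have sub: "?o l \<subseteq> B m" for l using option_ball_subset assms by auto
  have "?t (?o 0) + ?t (?o 1) + ?t (?o 2) \<le> 2 * ?t (B m)"
    unfolding toll_def sum.distrib[symmetric] sum_distrib_left
  proof (rule sum_mono, clarify)
    fix n k assume nk: "n \<le> m" "k \<le> Suc n"
    let ?s = "strip (S n k (B n)) (radius (B n) / R ^ (k + 20))"
    let ?c = "\<lambda>T. if ?s \<inter> T = {} then 0 else (4/5) ^ (n + k + 20) :: real"
    show "?c (?o 0) + ?c (?o 1) + ?c (?o 2) \<le> 2 * ?c (B m)"
    proof (cases "?s \<inter> B m = {}")
      case True
      then have "?s \<inter> ?o l = {}" for l using sub by blast
      then show ?thesis by simp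
    next
      case False
      obtain l where "l < 3" "?s \<inter> ?o l = {}"
        using thin_strip_misses_option[OF assms(1,3) thin[OF nk False]] by blast
      moreover from \<open>l < 3\<close> have "l = 0 \<or> l = 1 \<or> l = 2" by auto
      ultimately show ?thesis using False by auto
    qed
  qed
  then show ?thesis using l(3)[of 0] l(3)[of 1] l(3)[of 2] unfolding l(2) by linarith
qed

section \<open>Plays against the strategy\<close>

context
  fixes \<alpha> \<beta> R :: real
    and S :: "nat \<Rightarrow> nat \<Rightarrow> (real \<times> real) set \<Rightarrow> real \<times> real \<times> real"
    and B :: "nat \<Rightarrow> (real \<times> real) set"
  assumes \<alpha>: "0 < \<alpha>" "\<alpha> \<le> 1/42" and \<beta>: "0 < \<beta>" "\<beta> < 1" and R: "R = 1 / (\<alpha> * \<beta>)"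
begin

lemma R_ge_42: "R \<ge> 42"
proof -
  have "\<alpha> * \<beta> \<le> 1/42 * 1" using \<alpha> \<beta> by (intro mult_mono) auto
  then show ?thesis unfolding R using \<alpha> \<beta> by (simp add: field_simps)
qed

lemma legal_A_strategy:
  assumes "closed_ball (B m)"
  shows "legal_A \<alpha> (strategy \<alpha> R S) B m"
proof -
  obtain l where l: "A_ball (strategy \<alpha> R S) B m = option_ball \<alpha> (B m) l"
    using A_ball_strategy by metis
  have "radius (B m) > 0" using closed_ball_eq_cball[OF assms] by simp
  then have "\<alpha> * radius (B m) > 0" using \<alpha> by simp
  then have "closed_ball (option_ball \<alpha> (B m) l)"
    "diameter (option_ball \<alpha> (B m) l) = 2 * (\<alpha> * radius (B m))"
    unfolding closed_ball_def option_ball_def by (blast, simp)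
  then show ?thesis
    unfolding legal_A_def l using option_ball_subset[OF assms] \<alpha> by (simp add: radius_def)
qed

context
  assumes legal: "\<And>n. legal_B \<beta> (strategy \<alpha> R S) B n"
begin

lemma play_closed_ball: "closed_ball (B n)"
  using legal[of n] by (cases n) auto

lemma play_radius_Suc: "radius (B (Suc n)) = radius (B n) / R"
  using legal[of "Suc n"] legal_A_strategy[OF play_closed_ball, of n] \<alpha> \<beta>
  by (simp add: legal_A_def radius_def R)

lemma play_radius: "radius (B n) = radius (B 0) / R ^ n"
  by (induction n) (simp_all add: play_radius_Suc field_simps)

lemma play_subset: "B (Suc n) \<subseteq> A_ball (strategy \<alpha> R S) B n" "B (Suc n) \<subseteq> B n"
  using legal[of "Suc n"] legal_A_strategy[OF play_closed_ball, of n] by (auto simp: legal_A_def)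

lemma play_point: "\<exists>X. (\<Inter>n. B n) = {X}"
proof (rule decreasing_closed_nest_sing)
  show "closed (B n)" for n using closed_ball_eq_cball[OF play_closed_ball] by (metis closed_cball)
  show "B n \<noteq> {}" for n
    using closed_ball_eq_cball[OF play_closed_ball[of n]] by (metis cball_eq_empty not_less_iff_gr_or_eq)
  show "B n \<subseteq> B m" if "m \<le> n" for m n
    using lift_Suc_antimono_le[of B, OF play_subset(2) that] .
  fix e :: real assume "e > 0"
  have "(\<lambda>n. 2 * radius (B 0) * (1/R) ^ n) \<longlonglongrightarrow> 2 * radius (B 0) * 0"
    using R_ge_42 by (intro tendsto_intros LIMSEQ_power_zero) auto
  then have "\<forall>\<^sub>F n in sequentially. 2 * radius (B 0) * (1/R) ^ n < e"
    using \<open>e > 0\<close> by (auto dest: order_tendstoD)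
  then obtain n where n: "2 * radius (B 0) * (1/R) ^ n < e"
    by (auto simp: eventually_sequentially)
  have "dist x y < e" if "x \<in> B n" "y \<in> B n" for x y
  proof -
    have "dist (centre (B n)) x \<le> radius (B n)" "dist (centre (B n)) y \<le> radius (B n)"
      using that closed_ball_eq_cball[OF play_closed_ball[of n]] by (metis mem_cball)+
    then have "dist x y \<le> 2 * radius (B n)"
      using dist_triangle3[of x y "centre (B n)"] by linarith
    then show ?thesis using n play_radius[of n] by (simp add: power_divide)
  qed
  then show "\<exists>n. \<forall>x\<in>B n. \<forall>y\<in>B n. dist x y < e" by blast
qed

text \<open>A strip that still meets \<open>B m\<close> contributes its full price to the toll, so
  an old one would exceed the budget by itself.\<close>

lemma dead_strip:
  assumes "toll R S B m (B m) \<le> 30 * (4/5) ^ (m + 20)" "n \<le> m" "k \<le> Suc n"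
    and "strip (S n k (B n)) (radius (B n) / R ^ (k + 20)) \<inter> B m \<noteq> {}"
  shows "m < n + k + 20"
proof (rule ccontr)
  assume "\<not> ?thesis"
  then have "(4/5::real) ^ m \<le> (4/5) ^ (n + k + 20)" by (intro power_decreasing) auto
  also have "\<dots> = (\<Sum>(n, k) \<in> {(n, k)}.
     if strip (S n k (B n)) (radius (B n) / R ^ (k + 20)) \<inter> B m = {} then 0
     else (4/5) ^ (n + k + 20))" using assms by simp
  also have "\<dots> \<le> toll R S B m (B m)"
    unfolding toll_def using assms(2,3) by (intro sum_mono2) (auto split: if_splits)
  also note assms(1)
  also have "30 * (4/5) ^ (m + 20) = (30 * (4/5::real) ^ 20) * (4/5) ^ m" by (simp add: power_add)
  \<comment> \<open>The shift 20 is chosen to give \<open>30 * (4/5) ^ 20 < 1\<close>.\<close>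
  also have "\<dots> < 1 * (4/5) ^ m" by (intro mult_strict_right_mono) (auto simp: power_divide)
  finally show False by simp
qed

text \<open>The budget sustains itself: at stage \<open>m\<close> it yields, through
  \<open>dead_strip\<close>, that all strips still meeting \<open>B m\<close> are thin, and then
  \<open>toll_thin\<close> applies to the next move.\<close>

lemma play_toll: "toll R S B m (B m) \<le> 30 * (4/5) ^ (m + 20)"
proof (induction m)
  case 0
  show ?case using toll_0[of R S B "B 0"] by (simp add: power_divide)
next
  case (Suc m)
  have "radius (B n) / R ^ (k + 20) \<le> radius (B m) / 42"
    if nk: "n \<le> m" "k \<le> Suc n"
      and meets: "strip (S n k (B n)) (radius (B n) / R ^ (k + 20)) \<inter> B m \<noteq> {}" for n k
  proof -
    have "m < n + k + 20" using dead_strip[OF Suc nk meets] .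
    \<comment> \<open>The strict inequality leaves one factor \<open>R\<close> to spare, and this
      factor is at least 42.\<close>
    then have "R ^ Suc m \<le> R ^ (n + (k + 20))" using R_ge_42 by (intro power_increasing) auto
    moreover have "42 * R ^ m \<le> R ^ Suc m" using R_ge_42 by simp
    ultimately have "R ^ m * 42 \<le> R ^ n * R ^ (k + 20)" by (simp add: power_add)
    moreover have "radius (B 0) > 0" using closed_ball_eq_cball[OF play_closed_ball] by simp
    ultimately have "radius (B 0) / (R ^ n * R ^ (k + 20)) \<le> radius (B 0) / (R ^ m * 42)"
      using R_ge_42 by (intro divide_left_mono) auto
    then show ?thesis using play_radius[of n] play_radius[of m] by simp
  qed
  then have "toll R S B m (A_ball (strategy \<alpha> R S) B m) \<le> 2/3 * toll R S B m (B m)"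
    by (intro toll_thin play_closed_ball \<alpha>)
  moreover have "toll R S B m (B (Suc m)) \<le> toll R S B m (A_ball (strategy \<alpha> R S) B m)"
    by (intro toll_mono play_subset)
  moreover note toll_Suc[of R S B m "B (Suc m)"] Suc
  ultimately have "toll R S B (Suc m) (B (Suc m))
      \<le> 2/3 * (30 * (4/5) ^ (m + 20)) + 5 * (4/5) ^ (Suc m + 20)" by linarith
  \<comment> \<open>The budget is a fixed point of the recursion: 2/3 * 30 + 5 * 4/5 = 24 = 30 *
    4/5.\<close>
  then show ?case unfolding add_Suc power_Suc by linarith
qed

text \<open>At stage \<open>m = n + k + 20\<close> the conclusion of \<open>dead_strip\<close> would
  read \<open>m < m\<close>, so the strip no longer meets that ball, which contains
  \<open>X\<close>.\<close>

lemma play_avoids: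
  assumes "X \<in> (\<Inter>n. B n)" "k \<le> Suc n"
  shows "X \<notin> strip (S n k (B n)) (radius (B n) / R ^ (k + 20))"
  using dead_strip[OF play_toll[of "n + k + 20"], of n k] assms by auto

end

end

subsection \<open>Rational points and attached lines\<close>

lemma powr_le_mult_powr:
  fixes a b t D :: real
  assumes "0 \<le> a" "0 \<le> b" "a \<le> D * b" "1 \<le> D" "0 \<le> t" "t \<le> 1"
  shows "a powr t \<le> D * b powr t"
proof -
  have "a powr t \<le> (D * b) powr t" using assms by (intro powr_mono2) auto
  also have "\<dots> = D powr t * b powr t" using assms by (simp add: powr_mult)
  also have "\<dots> \<le> D * b powr t"
    using powr_mono[of t 1 D] assms by (intro mult_right_mono) auto
  finally show ?thesis .
qed

text \<open>The recurring estimate: a line coefficient of order \<open>s powr t\<close> meets an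
  approximation error of order \<open>s powr (- t)\<close> and the powers cancel. The term
  \<open>2 * \<rho> * k\<close> accounts for moving between two points of one ball.\<close>

lemma abs_mult_le_powr_cancel:
  fixes a u d e s t \<rho> h k :: real
  assumes "\<bar>a\<bar> \<le> d * s powr t" "\<bar>u\<bar> \<le> e * s powr (- t) + 2 * \<rho> * k" "k * \<bar>a\<bar> \<le> h"
    and "s > 0" "e \<ge> 0" "\<rho> \<ge> 0"
  shows "\<bar>a * u\<bar> \<le> d * e + 2 * \<rho> * h"
proof -
  have "\<bar>a * u\<bar> \<le> \<bar>a\<bar> * (e * s powr (- t) + 2 * \<rho> * k)"
    unfolding abs_mult using assms(2) by (intro mult_left_mono) auto
  also have "\<dots> = \<bar>a\<bar> * (e * s powr (- t)) + 2 * \<rho> * (k * \<bar>a\<bar>)" by (simp add: algebra_simps)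
  also have "\<dots> \<le> (d * s powr t) * (e * s powr (- t)) + 2 * \<rho> * h"
    using assms by (intro add_mono mult_right_mono mult_left_mono) auto
  also have "(d * s powr t) * (e * s powr (- t)) = d * e * (s powr t * s powr (- t))" by simp
  also have "s powr t * s powr (- t) = 1" using assms(4) by (simp add: powr_add[symmetric])
  finally show ?thesis by simp
qed

abbreviation size2 :: "int \<Rightarrow> int \<Rightarrow> real" where
  "size2 A B \<equiv> max \<bar>real_of_int A\<bar> \<bar>real_of_int B\<bar>"

locale weights =
  fixes i j :: real
  assumes i_pos: "0 < i" and j_pos: "0 < j" and sum_eq_1: "i + j = 1"
begin

text \<open>For \<open>q \<ge> 1\<close> this is the box around
  \<open>((p + \<gamma>) / q, (r + \<delta>) / q)\<close> with half-sides
  \<open>e / q powr (1 + i)\<close> and \<open>e / q powr (1 + j)\<close>.\<close>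

definition near :: "real \<Rightarrow> real \<Rightarrow> real \<Rightarrow> real \<Rightarrow> real \<Rightarrow> int \<Rightarrow> int \<Rightarrow> int \<Rightarrow> bool" where
  "near e \<gamma> \<delta> x y p r q \<longleftrightarrow>
     \<bar>q * x - p - \<gamma>\<bar> \<le> e * q powr (- i) \<and> \<bar>q * y - r - \<delta>\<bar> \<le> e * q powr (- j)"

definition is_line :: "int \<Rightarrow> int \<Rightarrow> int \<Rightarrow> int \<Rightarrow> int \<Rightarrow> int \<Rightarrow> bool" where
  "is_line p r q A B C \<longleftrightarrow> A * p + B * r + C * q = 0 \<and>
     \<bar>A\<bar> \<le> q powr i \<and> \<bar>B\<bar> \<le> q powr j \<and> (A \<noteq> 0 \<or> B \<noteq> 0)"

text \<open>Pigeonhole: there are more than \<open>q powr i * q powr j = q\<close> pairs of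
  admissible nonnegative coefficients, so two of them give the same residue of
  \<open>A * p + B * r\<close> modulo \<open>q\<close>; their difference is the line.\<close>

lemma ex_line:
  assumes "q \<ge> 1"
  shows "\<exists>A B C. is_line p r q A B C"
proof -
  define a b where "a = \<lfloor>q powr i\<rfloor>" and "b = \<lfloor>q powr j\<rfloor>"
  have ab: "a \<ge> 0" "b \<ge> 0" by (auto simp: a_def b_def)
  define T where "T = {0..a} \<times> {0..b}"
  define f where "f = (\<lambda>(A, B). (A * p + B * r) mod q)"
  have "real_of_int q = q powr i * q powr j"
    using assms sum_eq_1 by (simp add: powr_add[symmetric])
  also have "\<dots> < real_of_int (a + 1) * real_of_int (b + 1)"
  proof (intro mult_strict_mono)
    show "q powr i < real_of_int (a + 1)" "q powr j < real_of_int (b + 1)"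
      unfolding a_def b_def by linarith+
  qed (use ab in auto)
  finally have "q < (a + 1) * (b + 1)" by (simp only: of_int_mult[symmetric] of_int_less_iff)
  moreover have "int (card T) = (a + 1) * (b + 1)"
    using ab unfolding T_def by (simp add: card_cartesian_product)
  moreover have "card (f ` T) \<le> nat q"
  proof -
    have "f ` T \<subseteq> {0..<q}" using assms by (auto simp: f_def)
    then show ?thesis using card_mono[of "{0..<q}" "f ` T"] by simp
  qed
  ultimately have "card (f ` T) < card T" using assms by linarith
  then have "\<not> inj_on f T" by (rule pigeonhole)
  then obtain A1 B1 A2 B2 where 1: "(A1, B1) \<in> T" "(A2, B2) \<in> T" "f (A1, B1) = f (A2, B2)"
      "(A1, B1) \<noteq> (A2, B2)"
    unfolding inj_on_def by fast
  define A B where "A = A1 - A2" and "B = B1 - B2"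
  have "q dvd (A1 * p + B1 * r) - (A2 * p + B2 * r)"
    using 1(3) by (simp add: f_def mod_eq_dvd_iff)
  also have "(A1 * p + B1 * r) - (A2 * p + B2 * r) = A * p + B * r"
    by (simp add: A_def B_def algebra_simps)
  finally obtain C where "A * p + B * r = q * C" by (elim dvdE)
  moreover have "\<bar>A\<bar> \<le> a" "\<bar>B\<bar> \<le> b" using 1(1,2) by (auto simp: T_def A_def B_def)
  then have "\<bar>A\<bar> \<le> q powr i" "\<bar>B\<bar> \<le> q powr j" unfolding a_def b_def by linarith+
  ultimately have "is_line p r q A B (- C)"
    using 1(4) by (auto simp: is_line_def A_def B_def)
  then show ?thesis by blast
qed

lemma near_line:
  assumes "q \<ge> 1" "is_line p r q A B C" "near e 0 0 x y p r q" "e \<ge> 0"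
  shows "q * \<bar>A * x + B * y + C\<bar> \<le> 2 * e"
proof -
  have "\<bar>A * (q * x - p)\<bar> \<le> 1 * e + 2 * 0 * 0" "\<bar>B * (q * y - r)\<bar> \<le> 1 * e + 2 * 0 * 0"
    by (rule abs_mult_le_powr_cancel[where s = q and k = 0 and t = i]
        abs_mult_le_powr_cancel[where s = q and k = 0 and t = j];
        use assms in \<open>simp add: is_line_def near_def\<close>)+
  moreover have "real_of_int q * (A * x + B * y + C) = A * (q * x - p) + B * (q * y - r)"
  proof -
    have "real_of_int (A * p + B * r + C * q) = 0" using assms(2) by (simp add: is_line_def)
    then show ?thesis by (simp add: algebra_simps)
  qed
  ultimately have "\<bar>real_of_int q * (A * x + B * y + C)\<bar> \<le> 2 * e" by linarith
  then show ?thesis using assms(1) by (simp add: abs_mult)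
qed

end

section \<open>Two rational points of comparable size\<close>

text \<open>The point \<open>(x, y)\<close> lies in the box of the first rational point, while the
  box of the second is only assumed to come as close as two points of a ball of radius \<rho> are;
  hence the extra \<open>2 * \<rho> * q'\<close>. \<open>D\<close> compares the denominators,
  \<open>H\<close> bounds both heights, and \<open>G\<close> will bound the second line at
  \<open>(x, y)\<close> multiplied by \<open>q'\<close>.\<close>

locale two_points = weights +
  fixes p r q A B C p' r' q' A' B' C' :: int and x y e \<rho> H D G :: real
  assumes q: "q \<ge> 1" "q' \<ge> 1"
    and D: "D \<ge> 1" "q \<le> D * q'" "q' \<le> D * q"
    and line: "is_line p r q A B C" and line': "is_line p' r' q' A' B' C'"
    and H: "q * size2 A B \<le> H" and H': "q' * size2 A' B' \<le> H"
    and near: "near e 0 0 x y p r q"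
    and near': "\<bar>q' * x - p'\<bar> \<le> e * q' powr (- i) + 2 * \<rho> * q'"
      "\<bar>q' * y - r'\<bar> \<le> e * q' powr (- j) + 2 * \<rho> * q'"
    and e: "e > 0" and \<rho>: "\<rho> \<ge> 0"
    and G: "G = 2 * e + 4 * \<rho> * H"
begin

lemma H_nonneg: "H \<ge> 0"
proof -
  have "0 \<le> q * size2 A B" using q by simp
  then show ?thesis using H by linarith
qed

lemma G_ge: "2 * e \<le> G" "G \<ge> 0"
  using H_nonneg \<rho> e G by auto

lemma powr_q_ratio:
  assumes "0 \<le> t" "t \<le> 1"
  shows "q powr t \<le> D * q' powr t" "q' powr t \<le> D * q powr t"
  using assms q D by (auto intro!: powr_le_mult_powr)

lemma le_1: "i \<le> 1" "j \<le> 1" using i_pos j_pos sum_eq_1 by linarith+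

lemma size2_le: "q * \<bar>real_of_int A\<bar> \<le> H" "q * \<bar>real_of_int B\<bar> \<le> H"
  "q' * \<bar>real_of_int A'\<bar> \<le> H" "q' * \<bar>real_of_int B'\<bar> \<le> H"
  by (rule order_trans[OF mult_left_mono H] order_trans[OF mult_left_mono H']; use q in simp)+

lemma value_le: "q * \<bar>A * x + B * y + C\<bar> \<le> 2 * e"
  using near_line[OF q(1) line near] e by simp

lemma value'_le: "q' * \<bar>A' * x + B' * y + C'\<bar> \<le> G"
proof -
  have 1: "\<bar>A' * (q' * x - p')\<bar> \<le> 1 * e + 2 * \<rho> * H" "\<bar>B' * (q' * y - r')\<bar> \<le> 1 * e + 2 * \<rho> * H"
    by (rule abs_mult_le_powr_cancel[where s = q' and k = q' and t = i]
        abs_mult_le_powr_cancel[where s = q' and k = q' and t = j];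
        use line' near' size2_le e \<rho> q in \<open>simp add: is_line_def\<close>)+
  have "real_of_int q' * (A' * x + B' * y + C') = A' * (q' * x - p') + B' * (q' * y - r')"
  proof -
    have "real_of_int (A' * p' + B' * r' + C' * q') = 0" using line' by (simp add: is_line_def)
    then show ?thesis by (simp add: algebra_simps)
  qed
  then have "\<bar>real_of_int q' * (A' * x + B' * y + C')\<bar> \<le> G" using 1 G by linarith
  then show ?thesis using q by (simp add: abs_mult)
qed

lemma value_le_q': "q' * \<bar>A * x + B * y + C\<bar> \<le> D * (2 * e)"
proof -
  have "q' * \<bar>A * x + B * y + C\<bar> \<le> (D * q) * \<bar>A * x + B * y + C\<bar>"
    using D by (intro mult_right_mono) auto
  also have "\<dots> \<le> D * (2 * e)" using value_le D by (simp add: mult.assoc)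
  finally show ?thesis .
qed

lemma value'_le_q: "q * \<bar>A' * x + B' * y + C'\<bar> \<le> D * G"
proof -
  have "q * \<bar>A' * x + B' * y + C'\<bar> \<le> (D * q') * \<bar>A' * x + B' * y + C'\<bar>"
    using D by (intro mult_right_mono) auto
  also have "\<dots> \<le> D * G" using value'_le D by (simp add: mult.assoc)
  finally show ?thesis .
qed

text \<open>Both left-hand sides are integers. Evaluating each line at \<open>(x, y)\<close> and
  correcting by the errors of the other rational point bounds them by
  \<open>2 * D * G\<close>.\<close>

lemma cross_incidence:
  assumes "2 * D * G < 1"
  shows "A * p' + B * r' + C * q' = 0" "A' * p + B' * r + C' * q = 0"
proof -
  have *: "q' * t \<le> D * H" if "q * t \<le> H" "t \<ge> 0" for t :: real
  proof -
    have "q' * t \<le> (D * q) * t" using D that by (intro mult_right_mono) auto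
    also have "\<dots> \<le> D * H" using D that by (simp add: mult.assoc)
    finally show ?thesis .
  qed
  have "\<bar>real_of_int A\<bar> \<le> D * q' powr i" "\<bar>real_of_int B\<bar> \<le> D * q' powr j"
    using line powr_q_ratio(1)[of i] powr_q_ratio(1)[of j] i_pos j_pos le_1
    by (auto simp: is_line_def)
  note * = this *
  have 1: "\<bar>A * (q' * x - p')\<bar> \<le> D * e + 2 * \<rho> * (D * H)"
    "\<bar>B * (q' * y - r')\<bar> \<le> D * e + 2 * \<rho> * (D * H)"
    by (rule abs_mult_le_powr_cancel[where s = q' and k = q' and t = i]
        abs_mult_le_powr_cancel[where s = q' and k = q' and t = j];
        use near' size2_le * e \<rho> q in simp)+
  have "real_of_int (A * p' + B * r' + C * q')
      = q' * (A * x + B * y + C) - A * (q' * x - p') - B * (q' * y - r')"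
    by (simp add: algebra_simps)
  moreover have "\<bar>q' * (A * x + B * y + C)\<bar> \<le> D * (2 * e)"
    using value_le_q' q by (simp add: abs_mult)
  ultimately have "\<bar>real_of_int (A * p' + B * r' + C * q')\<bar>
      \<le> D * (2 * e) + (D * e + 2 * \<rho> * (D * H)) + (D * e + 2 * \<rho> * (D * H))"
    using 1 by linarith
  also have "\<dots> = D * (G + 2 * e)" unfolding G by (simp add: algebra_simps)
  also have "\<dots> \<le> D * (2 * G)" using G_ge D by (intro mult_left_mono) auto
  finally show "A * p' + B * r' + C * q' = 0" using assms by linarith

  have "\<bar>real_of_int A'\<bar> \<le> D * q powr i" "\<bar>real_of_int B'\<bar> \<le> D * q powr j"
    using line' powr_q_ratio(2)[of i] powr_q_ratio(2)[of j] i_pos j_pos le_1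
    by (auto simp: is_line_def)
  note * = this
  have 2: "\<bar>A' * (q * x - p)\<bar> \<le> D * e + 2 * 0 * 0" "\<bar>B' * (q * y - r)\<bar> \<le> D * e + 2 * 0 * 0"
    by (rule abs_mult_le_powr_cancel[where s = q and k = 0 and t = i]
        abs_mult_le_powr_cancel[where s = q and k = 0 and t = j];
        use near * e q in \<open>simp add: near_def\<close>)+
  have "real_of_int (A' * p + B' * r + C' * q)
      = q * (A' * x + B' * y + C') - A' * (q * x - p) - B' * (q * y - r)"
    by (simp add: algebra_simps)
  moreover have "\<bar>q * (A' * x + B' * y + C')\<bar> \<le> D * G"
    using value'_le_q q by (simp add: abs_mult)
  ultimately have "\<bar>real_of_int (A' * p + B' * r + C' * q)\<bar> \<le> D * G + D * (2 * e)"
    using 2 by linarith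
  also have "\<dots> \<le> D * G + D * G" using G_ge D by (intro add_left_mono mult_left_mono) auto
  finally show "A' * p + B' * r + C' * q = 0" using assms by linarith
qed

lemma same_line_or_same_point:
  assumes "2 * D * G < 1"
  shows "A * B' = A' * B \<and> A * C' = A' * C \<and> B * C' = B' * C \<or> p * q' = p' * q \<and> r * q' = r' * q"
proof -
  note c = cross_incidence[OF assms]
  have l: "A * p + B * r + C * q = 0" "A' * p' + B' * r' + C' * q' = 0"
    using line line' by (simp_all add: is_line_def)
  define z1 z2 z3 where "z1 = B * C' - B' * C" and "z2 = C * A' - C' * A" and "z3 = A * B' - A' * B"
  \<comment> \<open>Both points are orthogonal to both lines, hence proportional to their cross product.\<close>
  have z: "z1 * q = z3 * p" "z2 * q = z3 * r" "z1 * q' = z3 * p'" "z2 * q' = z3 * r'"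
    using c l unfolding z1_def z2_def z3_def by algebra+
  show ?thesis
  proof (cases "z3 = 0")
    case True
    then have "z1 = 0" "z2 = 0" using z q by auto
    then show ?thesis using True by (simp add: z1_def z2_def z3_def mult.commute)
  next
    case False
    have "z3 * (p * q') = z3 * (p' * q)" "z3 * (r * q') = z3 * (r' * q)" using z by algebra+
    then show ?thesis using False by simp
  qed
qed

text \<open>Cramer's rule: the minors of the two lines are the homogeneous coordinates of their
  intersection, and each error is a combination of the two line values at \<open>(x, y)\<close> with
  coefficients of the lines.\<close>

lemma intersection_near:
  "\<bar>(A * B' - A' * B) * x - (B * C' - B' * C)\<bar> \<le> 2 * D * G * q powr (- i)"
  "\<bar>(A * B' - A' * B) * y - (C * A' - C' * A)\<bar> \<le> 2 * D * G * q powr (- j)"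
proof -
  define w w' where "w = A * x + B * y + C" and "w' = A' * x + B' * y + C'"
  \<comment> \<open>A coefficient of order \<open>q powr j\<close> times a line value of order
    \<open>1 / q\<close> is of order \<open>q powr (- i)\<close>, and likewise with the weights
    exchanged, since \<open>i + j = 1\<close>.\<close>
  have split: "q powr (i - 1) = q powr (- j)" "q powr (j - 1) = q powr (- i)"
    using sum_eq_1 by (auto intro!: arg_cong[of _ _ "\<lambda>t. q powr t"])
  have qd: "q powr t * (D * G / q) = D * G * q powr (t - 1)" for t
    using q by (simp add: powr_diff)
  have *: "\<bar>b' * w - b * w'\<bar> \<le> 2 * D * G * q powr (t - 1)"
    if t: "0 \<le> t" "t \<le> 1" and b: "\<bar>b\<bar> \<le> q powr t" "\<bar>b'\<bar> \<le> q' powr t" for b b' t :: real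
  proof -
    have "\<bar>b * w'\<bar> \<le> q powr t * (D * G / q)"
      unfolding abs_mult using b value'_le_q q D G_ge
      by (intro mult_mono) (auto simp: w'_def field_simps)
    moreover have "\<bar>b' * w\<bar> \<le> q powr t * (D * G / q)"
    proof -
      have "\<bar>b' * w\<bar> \<le> (D * q powr t) * (2 * e / q)"
        unfolding abs_mult using b powr_q_ratio(2)[OF t] value_le q D G_ge e
        by (intro mult_mono) (auto simp: w_def field_simps)
      also have "\<dots> \<le> (D * q powr t) * (G / q)"
        using G_ge D q by (intro mult_left_mono divide_right_mono) auto
      finally show ?thesis by (simp add: mult_ac)
    qed
    ultimately show ?thesis using qd[of t] by linarith
  qed
  have "(A * B' - A' * B) * x - (B * C' - B' * C) = B' * w - B * w'"
    "(A * B' - A' * B) * y - (C * A' - C' * A) = A * w' - A' * w"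
    by (simp_all add: w_def w'_def algebra_simps)
  then show "\<bar>(A * B' - A' * B) * x - (B * C' - B' * C)\<bar> \<le> 2 * D * G * q powr (- i)"
    "\<bar>(A * B' - A' * B) * y - (C * A' - C' * A)\<bar> \<le> 2 * D * G * q powr (- j)"
    using *[of j B B'] *[of i A A'] i_pos j_pos le_1 line line' split
    by (auto simp: is_line_def abs_minus_commute)
qed

text \<open>The hypotheses save a factor \<open>U\<close> in the coefficient of the larger weight,
  and each of the products \<open>A * B'\<close> and \<open>A' * B\<close> contains one such
  coefficient.\<close>

lemma intersection_denominator:
  fixes U :: real
  assumes "U * size2 A B \<le> q powr max i j" "U * size2 A' B' \<le> q' powr max i j" "U > 0"
  shows "\<bar>A * B' - A' * B\<bar> \<le> 2 * D * q / U"
proof -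
  have *: "U * (\<bar>a\<bar> * \<bar>b\<bar>) \<le> s powr i * t powr j"
    if "U * max \<bar>a\<bar> \<bar>b'\<bar> \<le> s powr max i j" "U * max \<bar>a'\<bar> \<bar>b\<bar> \<le> t powr max i j"
      "\<bar>a\<bar> \<le> s powr i" "\<bar>b\<bar> \<le> t powr j" for a b a' b' s t :: real
  proof (cases "j \<le> i")
    case True
    have "U * \<bar>a\<bar> \<le> U * max \<bar>a\<bar> \<bar>b'\<bar>" using assms(3) by (intro mult_left_mono) auto
    then have "U * \<bar>a\<bar> \<le> s powr i" using that True by (simp add: max_def)
    then have "(U * \<bar>a\<bar>) * \<bar>b\<bar> \<le> s powr i * t powr j"
      by (rule mult_mono) (use that(4) in simp_all)
    then show ?thesis by (simp add: mult.assoc)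
  next
    case False
    have "U * \<bar>b\<bar> \<le> U * max \<bar>a'\<bar> \<bar>b\<bar>" using assms(3) by (intro mult_left_mono) auto
    then have "U * \<bar>b\<bar> \<le> t powr j" using that False by (simp add: max_def)
    with that(3) have "\<bar>a\<bar> * (U * \<bar>b\<bar>) \<le> s powr i * t powr j"
      by (rule mult_mono) (use assms(3) in simp_all)
    then show ?thesis by (simp add: mult_ac)
  qed
  have q_split: "q powr i * q powr j = q" using q sum_eq_1 by (simp add: powr_add[symmetric])
  have "U * (\<bar>real_of_int A\<bar> * \<bar>real_of_int B'\<bar>) \<le> q powr i * q' powr j"
    by (rule *[of A B q A' B' q']) (use assms line line' in \<open>auto simp: is_line_def\<close>)
  also have "\<dots> \<le> q powr i * (D * q powr j)"
    using powr_q_ratio(2)[of j] j_pos le_1 by (intro mult_left_mono) auto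
  also have "\<dots> = D * q" using q_split by (simp add: mult.left_commute)
  finally have 1: "U * (\<bar>real_of_int A\<bar> * \<bar>real_of_int B'\<bar>) \<le> D * q" .
  have "U * (\<bar>real_of_int A'\<bar> * \<bar>real_of_int B\<bar>) \<le> q' powr i * q powr j"
    by (rule *[of A' B' q' A B q]) (use assms line line' in \<open>auto simp: is_line_def\<close>)
  also have "\<dots> \<le> (D * q powr i) * q powr j"
    using powr_q_ratio(2)[of i] i_pos le_1 by (intro mult_right_mono) auto
  also have "\<dots> = D * q" using q_split by (simp add: mult.assoc)
  finally have 2: "U * (\<bar>real_of_int A'\<bar> * \<bar>real_of_int B\<bar>) \<le> D * q" .
  have "\<bar>real_of_int (A * B' - A' * B)\<bar> \<le> \<bar>real_of_int A\<bar> * \<bar>real_of_int B'\<bar> + \<bar>real_of_int A'\<bar> * \<bar>real_of_int B\<bar>"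
    unfolding of_int_diff of_int_mult abs_mult[symmetric] by (rule abs_triangle_ineq4)
  then have "U * \<bar>real_of_int (A * B' - A' * B)\<bar> \<le> U * (\<bar>real_of_int A\<bar> * \<bar>real_of_int B'\<bar> + \<bar>real_of_int A'\<bar> * \<bar>real_of_int B\<bar>)"
    using assms(3) by (intro mult_left_mono) auto
  then have "U * \<bar>real_of_int (A * B' - A' * B)\<bar> \<le> 2 * D * q"
    using 1 2 by (simp add: algebra_simps)
  then show ?thesis using assms(3) by (simp add: field_simps)
qed

text \<open>If the lines crossed, their intersection would have a denominator below
  \<open>q\<close>, and by \<open>gain\<close> its box would contain \<open>(x, y)\<close>, against
  the minimality of \<open>q\<close>. If they are parallel, the other two minors are integers below
  one in modulus, so the lines agree.\<close>

lemma same_line_of_minimal: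
  fixes U :: real
  assumes U: "U * size2 A B \<le> q powr max i j" "U * size2 A' B' \<le> q' powr max i j"
    and "2 * D < U" and gain: "2 * D * G * (2 * D / U) powr min i j \<le> e"
    and small: "2 * D * G < q powr min i j"
    and minimal: "\<And>p0 r0 q0. \<lbrakk>1 \<le> q0; near e 0 0 x y p0 r0 q0\<rbrakk> \<Longrightarrow> q \<le> q0"
  shows "A * B' = A' * B \<and> A * C' = A' * C \<and> B * C' = B' * C"
proof -
  define z1 z2 z3 where "z1 = B * C' - B' * C" and "z2 = C * A' - C' * A" and "z3 = A * B' - A' * B"
  have "U > 0" using assms(3) D by linarith
  have close: "\<bar>z3 * x - z1\<bar> \<le> 2 * D * G * q powr (- i)" "\<bar>z3 * y - z2\<bar> \<le> 2 * D * G * q powr (- j)"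
    using intersection_near by (simp_all add: z1_def z2_def z3_def)
  have "\<bar>z3\<bar> \<le> 2 * D * q / U"
    using intersection_denominator[OF U \<open>U > 0\<close>] by (simp add: z3_def)
  then have z3: "\<bar>real_of_int z3\<bar> \<le> (2 * D / U) * q" by simp
  have "2 * D * G \<ge> 0" using D G_ge by simp
  have "z3 = 0"
  proof (rule ccontr)
    assume "z3 \<noteq> 0"
    have *: "2 * D * G * q powr (- t) \<le> e * \<bar>real_of_int z3\<bar> powr (- t)"
      if "min i j \<le> t" "t \<le> 1" for t
    proof -
      have "t > 0" using that i_pos j_pos by linarith
      have "\<bar>real_of_int z3\<bar> powr t \<le> ((2 * D / U) * q) powr t"
        using z3 \<open>t > 0\<close> by (intro powr_mono2) auto
      also have "\<dots> = (2 * D / U) powr t * q powr t"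
        by (rule powr_mult)
      \<comment> \<open>As \<open>2 * D / U\<close> is below one, the smallest exponent is the
        worst.\<close>
      also have "\<dots> \<le> (2 * D / U) powr min i j * q powr t"
        using D \<open>U > 0\<close> assms(3) that(1) by (intro mult_right_mono powr_mono') auto
      finally have "2 * D * G * \<bar>real_of_int z3\<bar> powr t
          \<le> 2 * D * G * ((2 * D / U) powr min i j * q powr t)"
        using \<open>2 * D * G \<ge> 0\<close> by (intro mult_left_mono)
      also have "\<dots> \<le> e * q powr t"
        using mult_right_mono[OF gain, of "q powr t"] by (simp add: mult.assoc)
      finally show ?thesis using \<open>z3 \<noteq> 0\<close> q by (simp add: powr_minus field_simps)
    qed
    have bd: "\<bar>z3 * x - z1\<bar> \<le> e * \<bar>real_of_int z3\<bar> powr (- i)"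
      "\<bar>z3 * y - z2\<bar> \<le> e * \<bar>real_of_int z3\<bar> powr (- j)"
      using close *[of i] *[of j] le_1 by auto
    \<comment> \<open>\<open>minimal\<close> speaks of positive denominators only, hence the
      sign.\<close>
    have "near e 0 0 x y (sgn z3 * z1) (sgn z3 * z2) \<bar>z3\<bar>"
    proof (cases "z3 > 0")
      case True
      then show ?thesis using bd by (simp add: near_def)
    next
      case False
      then have "z3 < 0" using \<open>z3 \<noteq> 0\<close> by simp
      moreover have "\<bar>- (z3 * x) + z1\<bar> = \<bar>z3 * x - z1\<bar>" "\<bar>- (z3 * y) + z2\<bar> = \<bar>z3 * y - z2\<bar>" by linarith+
      ultimately show ?thesis using bd by (simp add: near_def)
    qed
    then have "q \<le> \<bar>z3\<bar>" using minimal \<open>z3 \<noteq> 0\<close> by simp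
    then have "1 * real_of_int q \<le> (2 * D / U) * q" using z3 by linarith
    then have "1 \<le> 2 * D / U" by (rule mult_right_le_imp_le) (use q in simp)
    then show False using assms(3) \<open>U > 0\<close> by simp
  qed
  have lt1: "2 * D * G * q powr (- t) < 1" if "min i j \<le> t" for t
  proof -
    have "q powr min i j \<le> q powr t" using q that by (intro powr_mono) auto
    then have "2 * D * G < q powr t" using small by linarith
    then show ?thesis using q by (simp add: powr_minus field_simps)
  qed
  have "\<bar>real_of_int z1\<bar> < 1" "\<bar>real_of_int z2\<bar> < 1"
    using close lt1[of i] lt1[of j] \<open>z3 = 0\<close> by auto
  then have "z1 = 0" "z2 = 0" by linarith+
  then show ?thesis using \<open>z3 = 0\<close> by (simp add: z1_def z2_def z3_def mult.commute)
qed

end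

subsection \<open>Classes of rational points\<close>

lemma powr_le_mult_powr_imp_le:
  fixes a b t D :: real
  assumes "0 < a" "0 < b" "1 \<le> D" "1 \<le> t" "a powr t \<le> D * b powr t"
  shows "a \<le> D * b"
proof (rule ccontr)
  assume "\<not> a \<le> D * b"
  then have "(D * b) powr t < a powr t" using assms by (intro powr_less_mono2) auto
  moreover have "D * b powr t \<le> D powr t * b powr t"
    using powr_mono[of 1 t D] assms by (intro mult_right_mono) auto
  ultimately show False using assms(5) by (simp add: powr_mult)
qed

lemma ex_power_bracket:
  fixes b t :: real
  assumes "1 < b" "1 \<le> t"
  shows "\<exists>k. b ^ k \<le> t \<and> t < b ^ (k + 1)"
proof -
  define n where "n = (LEAST n. t < b ^ n)"
  have n: "t < b ^ n" unfolding n_def using LeastI_ex[OF real_arch_pow[OF assms(1), of t]] .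
  then have "n \<noteq> 0" using assms by (cases n) auto
  then obtain k where k: "n = k + 1" by (metis Suc_eq_plus1 not0_implies_Suc)
  then have "\<not> t < b ^ k" unfolding n_def by (intro not_less_Least) simp
  then show ?thesis using n k by (auto intro!: exI[of _ k])
qed

text \<open>Proportional coefficient vectors have the same normalised value at a point; this carries
  a bound from one line of a class to another.\<close>

lemma proportional_lines:
  fixes A B C A' B' C' :: int and x y :: real
  assumes "A * B' = A' * B" "A * C' = A' * C" "B * C' = B' * C"
  shows "size2 A B * \<bar>A' * x + B' * y + C'\<bar> = size2 A' B' * \<bar>A * x + B * y + C\<bar>"
proof -
  have r: "real_of_int A * B' = real_of_int A' * B" "real_of_int A * C' = real_of_int A' * C"
    "real_of_int B * C' = real_of_int B' * C"
    using assms by (metis of_int_mult)+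
  have "A * (A' * x + B' * y + C') = A' * (A * x + B * y + C)"
    "B * (A' * x + B' * y + C') = B' * (A * x + B * y + C)"
    using r by algebra+
  then have "\<bar>real_of_int A\<bar> * \<bar>A' * x + B' * y + C'\<bar> = \<bar>real_of_int A'\<bar> * \<bar>A * x + B * y + C\<bar>"
    "\<bar>real_of_int B\<bar> * \<bar>A' * x + B' * y + C'\<bar> = \<bar>real_of_int B'\<bar> * \<bar>A * x + B * y + C\<bar>"
    by (metis abs_mult)+
  then show ?thesis by (simp only: max_mult_distrib_right abs_ge_zero if_True)
qed

context weights
begin

abbreviation w_min :: real where "w_min \<equiv> min i j"
abbreviation w_max :: real where "w_max \<equiv> max i j"

lemma w_bounds: "0 < w_min" "w_min \<le> 1/2" "w_min \<le> i" "w_min \<le> j" "0 < w_max" "w_max \<le> 1" "i \<le> w_max" "j \<le> w_max" "w_min \<le> 1"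
  using i_pos j_pos sum_eq_1 by (auto simp: min_def max_def)

text \<open>Lowest terms, phrased by the least denominator so as to follow directly from minimality.
  Two reduced triples of one point coincide and therefore have the same attached line.\<close>

definition reduced :: "int \<Rightarrow> int \<Rightarrow> int \<Rightarrow> bool" where
  "reduced p r q \<longleftrightarrow> 1 \<le> q \<and>
     (\<forall>p' r' q'. 1 \<le> q' \<longrightarrow> p * q' = p' * q \<longrightarrow> r * q' = r' * q \<longrightarrow> q \<le> q')"

definition attached :: "int \<Rightarrow> int \<Rightarrow> int \<Rightarrow> int \<times> int \<times> int" where
  "attached p r q = (SOME (A, B, C). is_line p r q A B C)"

lemma attached:
  assumes "q \<ge> 1"
  obtains A B C where "attached p r q = (A, B, C)" "is_line p r q A B C"
proof -
  have "\<exists>L. case L of (A, B, C) \<Rightarrow> is_line p r q A B C" using ex_line[OF assms] by auto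
  then have "case attached p r q of (A, B, C) \<Rightarrow> is_line p r q A B C"
    unfolding attached_def by (rule someI_ex)
  then show ?thesis using that by (cases "attached p r q") auto
qed

lemma is_line_size2:
  assumes "q \<ge> 1" "is_line p r q A B C"
  shows "1 \<le> size2 A B" "size2 A B \<le> q powr w_max"
proof -
  show "1 \<le> size2 A B" using assms(2) unfolding is_line_def by (auto simp: le_max_iff_disj)
  have "q powr i \<le> q powr w_max" "q powr j \<le> q powr w_max" using assms(1) by (auto intro!: powr_mono)
  then show "size2 A B \<le> q powr w_max" using assms(2) unfolding is_line_def by auto
qed

text \<open>The parameter \<open>k\<close> measures how much larger \<open>q\<close> is than forced by the height
  \<open>q * size2 A B\<close> of the attached line; the larger \<open>k\<close>, the earlier the line is dealt with.\<close>

definition in_class :: "real \<Rightarrow> nat \<Rightarrow> real \<Rightarrow> real \<Rightarrow> nat \<Rightarrow> (real \<times> real) set \<Rightarrow>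
    int \<Rightarrow> int \<Rightarrow> int \<Rightarrow> int \<Rightarrow> int \<Rightarrow> int \<Rightarrow> bool" where
  "in_class R \<Lambda> \<eta> e k b p r q A B C \<longleftrightarrow>
     reduced p r q \<and> attached p r q = (A, B, C) \<and> (\<exists>x y. (x, y) \<in> b \<and> near e 0 0 x y p r q) \<and>
     R ^ (\<Lambda> * k) * (q * size2 A B) \<le> q powr (1 + w_max) \<and>
     q powr (1 + w_max) < R ^ (\<Lambda> * (k + 1)) * (q * size2 A B) \<and>
     \<eta> * R ^ k \<le> radius b * (q * size2 A B) \<and> radius b * (q * size2 A B) < \<eta> * R ^ (k + 1)"

text \<open>The shorter side of the box is proportional to \<open>1 / q powr (1 + w_max)\<close>; a
  class collects the boxes whose shorter side is a fixed fraction of the radius of \<open>b\<close>,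
  up to a factor \<open>R\<close>.\<close>

definition in_class' :: "real \<Rightarrow> real \<Rightarrow> real \<Rightarrow> real \<Rightarrow> real \<Rightarrow> (real \<times> real) set \<Rightarrow>
    int \<Rightarrow> int \<Rightarrow> int \<Rightarrow> bool" where
  "in_class' R \<gamma> \<delta> \<eta> e b p r q \<longleftrightarrow>
     1 \<le> q \<and> (\<exists>x y. (x, y) \<in> b \<and> near e \<gamma> \<delta> x y p r q) \<and>
     \<eta> \<le> radius b * q powr (1 + w_max) \<and> radius b * q powr (1 + w_max) < \<eta> * R"

text \<open>The centre line of the box along its longer side; the shorter side belongs to the larger
  weight.\<close>

definition axis_line :: "real \<Rightarrow> real \<Rightarrow> int \<Rightarrow> int \<Rightarrow> int \<Rightarrow> real \<times> real \<times> real" where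
  "axis_line \<gamma> \<delta> p r q = (if j \<le> i then (1, 0, - ((p + \<gamma>) / q)) else (0, 1, - ((r + \<delta>) / q)))"

lemma closed_ball_coordinates:
  assumes "closed_ball b" "(x, y) \<in> b" "(x', y') \<in> b"
  shows "\<bar>x - x'\<bar> \<le> 2 * radius b" "\<bar>y - y'\<bar> \<le> 2 * radius b"
proof -
  have "dist (centre b) (x, y) \<le> radius b" "dist (centre b) (x', y') \<le> radius b"
    using assms closed_ball_eq_cball[OF assms(1)] by (metis mem_cball)+
  then have "dist (x, y) (x', y') \<le> 2 * radius b"
    using dist_triangle3[of "(x, y)" "(x', y')" "centre b"] by linarith
  then show "\<bar>x - x'\<bar> \<le> 2 * radius b" "\<bar>y - y'\<bar> \<le> 2 * radius b"
    using dist_fst_le[of "(x, y)" "(x', y')"] dist_snd_le[of "(x, y)" "(x', y')"]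
    by (auto simp: dist_real_def)
qed

lemma near_transfer:
  assumes "near e \<gamma> \<delta> x' y' p r q" "\<bar>x - x'\<bar> \<le> d" "\<bar>y - y'\<bar> \<le> d" "q \<ge> 1"
  shows "\<bar>q * x - p - \<gamma>\<bar> \<le> e * q powr (- i) + d * q" "\<bar>q * y - r - \<delta>\<bar> \<le> e * q powr (- j) + d * q"
proof -
  have "\<bar>q * (x - x')\<bar> \<le> d * q" "\<bar>q * (y - y')\<bar> \<le> d * q"
    using assms(2-4) by (simp_all add: abs_mult mult.commute)
  moreover have "q * x - p - \<gamma> = (q * x' - p - \<gamma>) + q * (x - x')"
    "q * y - r - \<delta> = (q * y' - r - \<delta>) + q * (y - y')" by (simp_all add: algebra_simps)
  ultimately show "\<bar>q * x - p - \<gamma>\<bar> \<le> e * q powr (- i) + d * q"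
    "\<bar>q * y - r - \<delta>\<bar> \<le> e * q powr (- j) + d * q"
    using assms(1) unfolding near_def by linarith+
qed

end

section \<open>Homogeneous approximation\<close>

text \<open>\<Lambda> is so large that the gain \<open>R ^ (\<Lambda> * k)\<close>, raised to the
  smaller weight, is still at least \<open>R ^ (2 * k)\<close>. \<eta> makes the integers of
  \<open>cross_incidence\<close> vanish for small \<open>k\<close>. The 22 in \<open>e\<close> makes
  the box of a point of class \<open>k\<close> fit into a strip of half-width
  \<open>radius b / R ^ (Suc k + 20)\<close>.\<close>

locale scales = weights +
  fixes R \<eta> e :: real and \<Lambda> :: nat
  assumes R: "R \<ge> 42" and \<Lambda>: "2 \<le> \<Lambda> * min i j"
    and \<eta>: "0 < \<eta>" "\<eta> \<le> 1 / R ^ (3 * \<Lambda> + 28)"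
    and e_def: "e = \<eta> / R ^ 22"
begin

lemma \<Lambda>_ge: "\<Lambda> \<ge> 4"
proof -
  have "\<Lambda> * w_min \<le> \<Lambda> * (1/2)" using w_bounds by (intro mult_left_mono) auto
  then show ?thesis using \<Lambda> by linarith
qed

lemma e: "0 < e" "e \<le> \<eta>" "e \<le> 1"
proof -
  have "1 \<le> R ^ 22" "1 \<le> R ^ (3 * \<Lambda> + 28)" using R by (auto intro!: one_le_power)
  then show "0 < e" "e \<le> \<eta>" using R \<eta> by (auto simp: e_def field_simps)
  moreover have "1 / R ^ (3 * \<Lambda> + 28) \<le> 1" using \<open>1 \<le> R ^ (3 * \<Lambda> + 28)\<close> by simp
  ultimately show "e \<le> 1" using \<eta> by linarith
qed

lemma powr_R_ge: "R ^ k \<le> (R ^ (\<Lambda> * k)) powr (w_min / 2)" "R ^ (2 * k) \<le> (R ^ (\<Lambda> * k)) powr w_min"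
proof -
  have "(R ^ (\<Lambda> * k)) powr s = R powr (k * (\<Lambda> * s))" for s :: real
    using R by (simp add: powr_realpow[symmetric] powr_powr mult_ac)
  moreover have "R powr (k * 1) \<le> R powr (k * (\<Lambda> * (w_min / 2)))" "R powr (k * 2) \<le> R powr (k * (\<Lambda> * w_min))"
    using R \<Lambda> by (intro powr_mono mult_left_mono; simp)+
  moreover have "R powr (k * 1) = R ^ k" "R powr (k * 2) = R ^ (2 * k)"
    using R powr_realpow[of R k] powr_realpow[of R "2 * k"] by (simp_all add: mult.commute)
  ultimately show "R ^ k \<le> (R ^ (\<Lambda> * k)) powr (w_min / 2)" "R ^ (2 * k) \<le> (R ^ (\<Lambda> * k)) powr w_min"
    by simp_all
qed

text \<open>Class and ball determine \<open>q powr (1 + w_max)\<close> up to a factor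
  \<open>R ^ \<Lambda>\<close> from the window of \<open>k\<close> and a factor \<open>R\<close>
  from the window of the height. The exponent is at least one, so the same factor serves for
  \<open>q\<close>.\<close>

lemma class_ratio:
  assumes "in_class R \<Lambda> \<eta> e k b p r q A B C" "in_class R \<Lambda> \<eta> e k b p' r' q' A' B' C'" "radius b > 0"
  shows "q \<le> R ^ (\<Lambda> + 1) * q'"
proof -
  have q: "1 \<le> q" "1 \<le> q'" using assms by (auto simp: in_class_def reduced_def)
  have "radius b * q powr (1 + w_max) \<le> radius b * (R ^ (\<Lambda> * (k + 1)) * (q * size2 A B))"
    using assms by (intro mult_left_mono) (auto simp: in_class_def)
  also have "\<dots> = R ^ (\<Lambda> * (k + 1)) * (radius b * (q * size2 A B))" by simp
  also have "\<dots> \<le> R ^ (\<Lambda> * (k + 1)) * (\<eta> * R ^ (k + 1))"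
    using assms R by (intro mult_left_mono) (auto simp: in_class_def)
  also have "\<dots> = R ^ (\<Lambda> + 1) * (R ^ (\<Lambda> * k) * (\<eta> * R ^ k))"
    by (simp add: power_add algebra_simps)
  also have "\<dots> \<le> R ^ (\<Lambda> + 1) * (R ^ (\<Lambda> * k) * (radius b * (q' * size2 A' B')))"
    using assms R by (intro mult_left_mono) (auto simp: in_class_def)
  also have "\<dots> = radius b * (R ^ (\<Lambda> + 1) * (R ^ (\<Lambda> * k) * (q' * size2 A' B')))" by simp
  also have "\<dots> \<le> radius b * (R ^ (\<Lambda> + 1) * q' powr (1 + w_max))"
    using assms R by (intro mult_left_mono) (auto simp: in_class_def)
  finally have "q powr (1 + w_max) \<le> R ^ (\<Lambda> + 1) * q' powr (1 + w_max)" using assms(3) by simp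
  moreover have "1 \<le> R ^ (\<Lambda> + 1)" using R by (intro one_le_power) simp
  ultimately show ?thesis
    using powr_le_mult_powr_imp_le[of q q' "R ^ (\<Lambda> + 1)" "1 + w_max"] q w_bounds(5) by simp
qed

lemma class_size2:
  assumes "in_class R \<Lambda> \<eta> e k b p r q A B C"
  shows "R ^ (\<Lambda> * k) * size2 A B \<le> q powr w_max"
proof -
  have q: "1 \<le> q" using assms by (auto simp: in_class_def reduced_def)
  have "q * (R ^ (\<Lambda> * k) * size2 A B) \<le> q * q powr w_max"
    using assms q by (simp add: in_class_def powr_add mult.left_commute)
  then show ?thesis using q by simp
qed

lemma class_same_line:
  assumes b: "closed_ball b" "(x, y) \<in> b"
    and cl: "in_class R \<Lambda> \<eta> e k b p r q A B C"
    and cl': "in_class R \<Lambda> \<eta> e k b p' r' q' A' B' C'"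
    and near: "near e 0 0 x y p r q"
    and minimal: "\<And>p0 r0 q0. \<lbrakk>1 \<le> q0; near e 0 0 x y p0 r0 q0\<rbrakk> \<Longrightarrow> q \<le> q0"
  shows "A * B' = A' * B \<and> A * C' = A' * C \<and> B * C' = B' * C"
proof -
  define \<rho> where "\<rho> = radius b"
  define D where "D = R ^ (\<Lambda> + 1)"
  define H where "H = \<eta> * R ^ (k + 1) / \<rho>"
  define G where "G = 2 * e + 4 * \<rho> * H"
  have \<rho>: "\<rho> > 0" using closed_ball_eq_cball[OF b(1)] by (simp add: \<rho>_def)
  have q: "1 \<le> q" "1 \<le> q'" using cl cl' by (auto simp: in_class_def reduced_def)
  have line: "is_line p r q A B C"
    using attached[OF q(1), of p r] cl unfolding in_class_def by auto
  have line': "is_line p' r' q' A' B' C'"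
    using attached[OF q(2), of p' r'] cl' unfolding in_class_def by auto
  obtain x' y' where xy': "(x', y') \<in> b" "near e 0 0 x' y' p' r' q'"
    using cl' by (auto simp: in_class_def)
  have near': "\<bar>q' * x - p'\<bar> \<le> e * q' powr (- i) + 2 * \<rho> * q'"
    "\<bar>q' * y - r'\<bar> \<le> e * q' powr (- j) + 2 * \<rho> * q'"
    using near_transfer[OF xy'(2) closed_ball_coordinates[OF b xy'(1)] q(2)] by (simp_all add: \<rho>_def)
  have D1: "D \<ge> 1" unfolding D_def using R by (intro one_le_power) auto
  have H\<rho>: "\<rho> * H = \<eta> * R ^ (k + 1)" using \<rho> by (simp add: H_def)
  note e\<eta> = e(2)
  interpret two_points i j p r q A B C p' r' q' A' B' C' x y e \<rho> H D G
  proof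
    show "q \<le> D * q'" "q' \<le> D * q"
      using class_ratio[OF cl cl'] class_ratio[OF cl' cl] \<rho> by (auto simp: D_def \<rho>_def)
    have "\<rho> * (q * size2 A B) \<le> \<eta> * R ^ (k + 1)" "\<rho> * (q' * size2 A' B') \<le> \<eta> * R ^ (k + 1)"
      using cl cl' by (auto simp: in_class_def \<rho>_def)
    then show "q * size2 A B \<le> H" "q' * size2 A' B' \<le> H"
      using \<rho> by (simp_all add: H_def field_simps)
  qed (use q D1 line line' near near' e \<rho> in \<open>auto simp: G_def\<close>)
  have "\<eta> * 1 \<le> \<eta> * R ^ (k + 1)" using R \<eta> by (intro mult_left_mono one_le_power) auto
  then have "G \<le> 6 * (\<eta> * R ^ (k + 1))" using e\<eta> H\<rho> unfolding G_def by linarith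
  then have "2 * D * G \<le> 2 * D * (6 * (\<eta> * R ^ (k + 1)))" using D1 by (intro mult_left_mono) auto
  then have DG: "2 * D * G \<le> \<eta> * (12 * R ^ (\<Lambda> + k + 2))" by (simp add: D_def power_add mult_ac)
  have pow: "c * R ^ s < R ^ t" if "c \<le> 24" "s < t" for c :: real and s t :: nat
  proof -
    have "c * R ^ s < R * R ^ s" using that R by (intro mult_strict_right_mono) auto
    also have "\<dots> = R ^ Suc s" by simp
    also have "\<dots> \<le> R ^ t" using that R by (intro power_increasing) auto
    finally show ?thesis .
  qed
  show ?thesis
  \<comment> \<open>From this threshold on
    \<open>24 * R ^ (2 * \<Lambda> + k + 25) \<le> R ^ (2 * k)\<close>, which gives the gain needed
    for minimality; below it \<open>\<Lambda> + k + 2 < 3 * \<Lambda> + 28\<close>, so the bound on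
    \<eta> suffices.\<close>
  proof (cases "k < 2 * \<Lambda> + 26")
    case True
    have "\<eta> * (12 * R ^ (\<Lambda> + k + 2)) < \<eta> * R ^ (3 * \<Lambda> + 28)"
      using pow[of 12 "\<Lambda> + k + 2" "3 * \<Lambda> + 28"] True \<eta> by (intro mult_strict_left_mono) auto
    also have "\<dots> \<le> 1" using \<eta> R by (simp add: field_simps)
    finally have "2 * D * G < 1" using DG by linarith
    from same_line_or_same_point[OF this] show ?thesis
    proof
      assume *: "p * q' = p' * q \<and> r * q' = r' * q"
      \<comment> \<open>Both triples are in lowest terms, so they agree, and the attached line is a
        function of the triple.\<close>
      then have "q \<le> q'" using cl q unfolding in_class_def reduced_def by blast
      moreover have "q' \<le> q" using * cl' q unfolding in_class_def reduced_def by (metis (no_types))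
      ultimately have "p = p'" "r = r'" "q = q'" using * q by auto
      then have "A = A'" "B = B'" "C = C'" using cl cl' by (auto simp: in_class_def)
      then show ?thesis by simp
    qed simp
  next
    case False
    define U where "U = R ^ (\<Lambda> * k)"
    have "U > 0" using R by (simp add: U_def)
    have "4 * k \<le> \<Lambda> * k" using \<Lambda>_ge by simp
    show ?thesis
    proof (rule same_line_of_minimal[OF _ _ _ _ _ minimal])
      show "U * size2 A B \<le> q powr w_max" "U * size2 A' B' \<le> q' powr w_max"
        using class_size2[OF cl] class_size2[OF cl'] by (auto simp: U_def)
      show "2 * D < U"
        unfolding D_def U_def by (rule pow) (use False \<open>4 * k \<le> \<Lambda> * k\<close> in linarith)+
      have "(2 * D / U) powr w_min = (2 * D) powr w_min / U powr w_min" by (rule powr_divide)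
      also have "\<dots> \<le> 2 * D / R ^ (2 * k)"
      proof (rule frac_le)
        show "(2 * D) powr w_min \<le> 2 * D" using powr_mono[of w_min 1 "2 * D"] D1 w_bounds by auto
        show "R ^ (2 * k) \<le> U powr w_min" using powr_R_ge(2) by (simp add: U_def)
      qed (use D1 R in auto)
      finally have "2 * D * G * (2 * D / U) powr w_min \<le> (\<eta> * (12 * R ^ (\<Lambda> + k + 2))) * (2 * D / R ^ (2 * k))"
        by (rule mult_mono[OF DG]) (use \<eta> R in simp_all)
      also have "\<dots> = \<eta> / R ^ 22 * (24 * R ^ (2 * \<Lambda> + k + 25) / R ^ (2 * k))"
      proof -
        have "R ^ (2 * \<Lambda> + k + 25) = R ^ 22 * (R ^ (\<Lambda> + k + 2) * D)"
          unfolding D_def power_add[symmetric] by (rule arg_cong[of _ _ "\<lambda>n. R ^ n"]) simp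
        then show ?thesis using R by simp
      qed
      also have "\<dots> \<le> \<eta> / R ^ 22 * 1"
        using pow[of 24 "2 * \<Lambda> + k + 25" "2 * k"] False \<eta> R
        by (intro mult_left_mono) (auto simp: field_simps)
      finally show "2 * D * G * (2 * D / U) powr w_min \<le> e" by (simp add: e_def)
      \<comment> \<open>A large class index forces a large denominator:
        \<open>U \<le> q powr 2\<close>, hence \<open>R ^ k \<le> q powr w_min\<close>, which
        exceeds \<open>2 * D * G\<close>.\<close>
      have "U * 1 \<le> U * (q * size2 A B)"
        using is_line_size2[OF q(1) line] q \<open>U > 0\<close> mult_mono[of 1 "real_of_int q" 1 "size2 A B"]
        by (intro mult_left_mono) auto
      also have "\<dots> \<le> q powr (1 + w_max)" using cl by (simp add: in_class_def U_def)
      also have "\<dots> \<le> q powr 2" using q w_bounds by (intro powr_mono) auto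
      finally have "U powr (w_min / 2) \<le> (q powr 2) powr (w_min / 2)"
        using \<open>U > 0\<close> w_bounds by (intro powr_mono2) auto
      also have "\<dots> = q powr w_min" by (simp add: powr_powr)
      finally have "R ^ k \<le> q powr w_min" using powr_R_ge(1)[of k] by (simp add: U_def)
      have "\<eta> * (12 * R ^ (\<Lambda> + k + 2)) \<le> 1 / R ^ (3 * \<Lambda> + 28) * (12 * R ^ (\<Lambda> + k + 2))"
        using \<eta> R by (intro mult_right_mono) auto
      also have "\<dots> < R ^ k"
        using pow[of 12 "\<Lambda> + k + 2" "k + (3 * \<Lambda> + 28)"] R by (simp add: power_add field_simps)
      finally show "2 * D * G < q powr w_min" using DG \<open>R ^ k \<le> q powr w_min\<close> by linarith
    qed
  qed
qed

text \<open>Relative to its coefficients the first line has value at most \<open>2 * e\<close> over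
  the height at \<open>(x, y)\<close>, and the height is at least
  \<open>\<eta> * R ^ k / radius b\<close>. As one line is prescribed per class, the bound is
  carried over to an arbitrary member by proportionality.\<close>

lemma class_in_strip:
  assumes b: "closed_ball b" "(x, y) \<in> b"
    and cl: "in_class R \<Lambda> \<eta> e k b p r q A B C"
    and cl': "in_class R \<Lambda> \<eta> e k b p' r' q' A' B' C'"
    and near: "near e 0 0 x y p r q"
    and minimal: "\<And>p0 r0 q0. \<lbrakk>1 \<le> q0; near e 0 0 x y p0 r0 q0\<rbrakk> \<Longrightarrow> q \<le> q0"
  shows "(x, y) \<in> strip (real_of_int A', real_of_int B', real_of_int C') (radius b / R ^ (Suc k + 20))"
proof -
  define v v' where "v = \<bar>A * x + B * y + C\<bar>" and "v' = \<bar>A' * x + B' * y + C'\<bar>"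
  have \<rho>: "radius b > 0" using closed_ball_eq_cball[OF b(1)] by simp
  have q: "1 \<le> q" "1 \<le> q'" using cl cl' by (auto simp: in_class_def reduced_def)
  have line: "is_line p r q A B C" "is_line p' r' q' A' B' C'"
    using attached[OF q(1), of p r] attached[OF q(2), of p' r'] cl cl' unfolding in_class_def by auto
  note M = is_line_size2(1)[OF q(1) line(1)] is_line_size2(1)[OF q(2) line(2)]
  have ratio: "size2 A B * v' = size2 A' B' * v"
    unfolding v_def v'_def using class_same_line[OF assms] by (intro proportional_lines) auto
  have "(q * v) * (\<eta> * R ^ k) \<le> (2 * e) * (radius b * (q * size2 A B))"
  proof (rule mult_mono)
    show "q * v \<le> 2 * e" using near_line[OF q(1) line(1) near] e by (simp add: v_def)
    show "\<eta> * R ^ k \<le> radius b * (q * size2 A B)" using cl by (simp only: in_class_def)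
  qed (use e \<eta> R in simp_all)
  also have "\<dots> = q * ((2 * e * radius b) * size2 A B)" by simp
  finally have "v * (\<eta> * R ^ k) \<le> 2 * e * radius b * size2 A B"
    using q by (simp add: mult.assoc)
  then have "\<eta> * (v * R ^ k) \<le> \<eta> * ((2 / R ^ 22) * radius b * size2 A B)"
    by (simp add: e_def mult_ac)
  then have "v * R ^ k \<le> (2 / R ^ 22) * radius b * size2 A B"
    by (rule mult_left_le_imp_le) (rule \<eta>(1))
  also have "\<dots> < (1 / R ^ 21) * radius b * size2 A B"
    using M \<rho> R by (intro mult_strict_right_mono) (auto simp: field_simps eval_nat_numeral)
  finally have "v * R ^ k < (1 / R ^ 21) * radius b * size2 A B" .
  then have "v < radius b / R ^ (Suc k + 20) * size2 A B"
    using R by (simp add: field_simps power_add)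
  then have "size2 A' B' * v < size2 A' B' * (radius b / R ^ (Suc k + 20) * size2 A B)"
    using M by (intro mult_strict_left_mono) auto
  then have "size2 A B * v' < size2 A B * (radius b / R ^ (Suc k + 20) * size2 A' B')"
    unfolding ratio by (simp add: mult_ac)
  then have "v' < radius b / R ^ (Suc k + 20) * size2 A' B'"
    by (rule mult_left_less_imp_less) (use M in simp)
  then show ?thesis by (simp add: strip_def v'_def)
qed

text \<open>First \<open>k\<close> is read off from \<open>q powr (1 + w_max)\<close> over the
  height, then \<open>n\<close> from the height. The bound \<open>k \<le> n\<close> is wanted
  because stage \<open>n\<close> has strips only up to index \<open>Suc n\<close>; it holds since
  \<open>R ^ (\<Lambda> * k)\<close> is at most the height and \<Lambda> is at least 4.\<close>

lemma ex_class:
  assumes "reduced p r q" "near e 0 0 x y p r q"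
    and b: "\<And>n. (x, y) \<in> b n" "\<And>n. radius (b n) = radius (b 0) / R ^ n" "\<eta> \<le> radius (b 0)"
  shows "\<exists>n k A B C. k \<le> n \<and> in_class R \<Lambda> \<eta> e k (b n) p r q A B C"
proof -
  have q: "1 \<le> q" using assms(1) by (simp add: reduced_def)
  obtain A B C where L: "attached p r q = (A, B, C)" "is_line p r q A B C" by (rule attached[OF q])
  define H where "H = q * size2 A B"
  note M = is_line_size2[OF q L(2)]
  have "real_of_int q * 1 \<le> H" unfolding H_def using M q by (intro mult_left_mono) auto
  then have H: "q \<le> H" "1 \<le> H" using q by linarith+
  have "H \<le> q * q powr w_max" unfolding H_def using M q by (intro mult_left_mono) auto
  then have t: "1 \<le> q powr (1 + w_max) / H" using H q by (simp add: powr_add)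
  obtain k where k: "(R ^ \<Lambda>) ^ k \<le> q powr (1 + w_max) / H" "q powr (1 + w_max) / H < (R ^ \<Lambda>) ^ (k + 1)"
    using ex_power_bracket[OF _ t, of "R ^ \<Lambda>"] R \<Lambda>_ge by (auto simp: one_less_power)
  have "q powr (1 + w_max) \<le> q powr 2" using q w_bounds by (intro powr_mono) auto
  also have "\<dots> = real_of_int q * q" using q by (simp add: power2_eq_square)
  also have "\<dots> \<le> H * H" using H q by (intro mult_mono) auto
  finally have "q powr (1 + w_max) / H \<le> H" using H by (simp add: field_simps)
  then have kH: "R ^ (\<Lambda> * k) \<le> H" using k(1) by (simp add: power_mult)
  have "R ^ k \<le> R ^ (\<Lambda> * k)" using R \<Lambda>_ge by (intro power_increasing) auto
  then have "R ^ k \<le> H" using kH by linarith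
  then have "\<eta> * R ^ k \<le> radius (b 0) * H" using b(3) \<eta> R by (intro mult_mono) auto
  then have s: "1 \<le> radius (b 0) * H / (\<eta> * R ^ k)" using \<eta> R by simp
  obtain n where n: "R ^ n \<le> radius (b 0) * H / (\<eta> * R ^ k)" "radius (b 0) * H / (\<eta> * R ^ k) < R ^ (n + 1)"
    using ex_power_bracket[OF _ s, of R] R by auto
  have "\<eta> * R ^ (\<Lambda> * k) \<le> radius (b 0) * H" using kH b(3) \<eta> R by (intro mult_mono) auto
  also have "\<dots> < R ^ (n + 1) * (\<eta> * R ^ k)" using n(2) \<eta> R by (simp add: field_simps)
  also have "\<dots> = \<eta> * R ^ (n + 1 + k)" by (simp add: power_add)
  finally have "R ^ (\<Lambda> * k) < R ^ (n + 1 + k)" using \<eta> by simp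
  then have "\<Lambda> * k < n + 1 + k" by (rule power_less_imp_less_exp[rotated]) (use R in simp)
  moreover have "4 * k \<le> \<Lambda> * k" using \<Lambda>_ge by simp
  ultimately have "k \<le> n" by linarith
  have "in_class R \<Lambda> \<eta> e k (b n) p r q A B C"
    unfolding in_class_def H_def[symmetric]
  proof (intro conjI)
    show "\<exists>x y. (x, y) \<in> b n \<and> near e 0 0 x y p r q" using b assms(2) by blast
    show "R ^ (\<Lambda> * k) * H \<le> q powr (1 + w_max)" using k(1) H by (simp add: power_mult field_simps)
    show "q powr (1 + w_max) < R ^ (\<Lambda> * (k + 1)) * H"
      using k(2) H unfolding power_mult by (simp add: field_simps)
    show "\<eta> * R ^ k \<le> radius (b n) * H"
      using n(1) \<eta> R unfolding b(2)[of n] by (simp add: field_simps)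
    show "radius (b n) * H < \<eta> * R ^ (k + 1)"
      using n(2) \<eta> R unfolding b(2)[of n] by (simp add: field_simps)
  qed (use assms(1) L in auto)
  then show ?thesis using \<open>k \<le> n\<close> by blast
qed

text \<open>\<open>avoid\<close> provides just one avoided strip per nonempty class, possibly that
  of another member; \<open>class_in_strip\<close> makes this enough for the point of least
  denominator.\<close>

lemma homogeneous_bad:
  assumes b: "\<And>n. closed_ball (b n)" "\<And>n. (x, y) \<in> b n" "\<And>n. radius (b n) = radius (b 0) / R ^ n"
      "\<eta> \<le> radius (b 0)"
    and avoid: "\<And>n k. k \<le> n \<Longrightarrow> \<exists>p r q A B C. in_class R \<Lambda> \<eta> e k (b n) p r q A B C \<Longrightarrow>
      \<exists>p r q A B C. in_class R \<Lambda> \<eta> e k (b n) p r q A B C \<and>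
        (x, y) \<notin> strip (real_of_int A, real_of_int B, real_of_int C) (radius (b n) / R ^ (Suc k + 20))"
    and "1 \<le> q"
  shows "\<not> near e 0 0 x y p r q"
proof
  assume "near e 0 0 x y p r q"
  define P where "P = (\<lambda>t. \<exists>p r. near e 0 0 x y p r (int t) \<and> 1 \<le> t)"
  have "P (nat q)" unfolding P_def using assms(6) \<open>near e 0 0 x y p r q\<close> by auto
  then have "P (LEAST t. P t)" by (rule LeastI)
  define q0 where "q0 = int (LEAST t. P t)"
  obtain p0 r0 where 0: "near e 0 0 x y p0 r0 q0" "1 \<le> q0"
    using \<open>P (LEAST t. P t)\<close> unfolding P_def q0_def by auto
  have minimal: "q0 \<le> q1" if "1 \<le> q1" "near e 0 0 x y p1 r1 q1" for p1 r1 q1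
  proof -
    have "P (nat q1)" unfolding P_def using that by auto
    then have "(LEAST t. P t) \<le> nat q1" by (rule Least_le)
    then show ?thesis using that by (simp add: q0_def)
  qed
  \<comment> \<open>A representation with a smaller denominator would be near as well: the error
    shrinks with the denominator while the tolerance grows.\<close>
  have "reduced p0 r0 q0"
    unfolding reduced_def
  proof (intro conjI allI impI)
    fix p' r' q' assume *: "1 \<le> q'" "p0 * q' = p' * q0" "r0 * q' = r' * q0"
    show "q0 \<le> q'"
    proof (rule ccontr)
      assume "\<not> q0 \<le> q'"
      have aux: "\<bar>q' * u - a'\<bar> \<le> e * q' powr (- t)"
        if "\<bar>q0 * u - a0\<bar> \<le> e * q0 powr (- t)" "a0 * q' = a' * q0" "t > 0" for u t :: real and a0 a' :: int
      proof -
        have "real_of_int a0 * q' = real_of_int a' * q0" using that(2) by (metis of_int_mult)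
        then have "q0 * (q' * u - a') = q' * (q0 * u - a0)" by algebra
        then have "q0 * \<bar>q' * u - a'\<bar> = q' * \<bar>q0 * u - a0\<bar>"
          using 0(2) *(1) by (metis abs_mult abs_of_nonneg of_int_0_le_iff order_trans zero_le_one)
        also have "\<dots> \<le> q0 * \<bar>q0 * u - a0\<bar>"
          using \<open>\<not> q0 \<le> q'\<close> by (intro mult_right_mono) auto
        finally have "\<bar>q' * u - a'\<bar> \<le> \<bar>q0 * u - a0\<bar>" using 0(2) by simp
        also have "\<dots> \<le> e * q0 powr (- t)" by fact
        also have "\<dots> \<le> e * q' powr (- t)"
          using \<open>\<not> q0 \<le> q'\<close> *(1) that(3) e by (intro mult_left_mono powr_mono2') auto
        finally show ?thesis .
      qed
      have "near e 0 0 x y p' r' q'"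
        using aux[of x p0 i p'] aux[of y r0 j r'] 0(1) * i_pos j_pos by (simp add: near_def)
      then show False using minimal *(1) \<open>\<not> q0 \<le> q'\<close> by blast
    qed
  qed (use 0 in auto)
  then obtain n k A B C where cl: "k \<le> n" "in_class R \<Lambda> \<eta> e k (b n) p0 r0 q0 A B C"
    using ex_class[OF _ 0(1) b(2,3,4)] by blast
  then obtain p' r' q' A' B' C' where cl': "in_class R \<Lambda> \<eta> e k (b n) p' r' q' A' B' C'"
      "(x, y) \<notin> strip (real_of_int A', real_of_int B', real_of_int C') (radius (b n) / R ^ (Suc k + 20))"
    using avoid[OF cl(1)] by blast
  have "(x, y) \<in> strip (real_of_int A', real_of_int B', real_of_int C') (radius (b n) / R ^ (Suc k + 20))"
    by (rule class_in_strip[OF b(1,2) cl(2) cl'(1) 0(1)]) (rule minimal)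
  then show False using cl'(2) by blast
qed


section \<open>Inhomogeneous approximation\<close>

context
  fixes \<eta>' e' \<gamma> \<delta> x y :: real
  assumes \<eta>': "0 < \<eta>'" "4 * R\<^sup>2 * \<eta>' \<le> e" and e': "e' = \<eta>' / R ^ 22"
    and bad: "\<And>p r q. 1 \<le> q \<Longrightarrow> \<not> near e 0 0 x y p r q"
begin

lemma e'_bounds: "0 < e'" "e' \<le> \<eta>'"
proof -
  have "1 \<le> R ^ 22" using R by (intro one_le_power) auto
  then show "0 < e'" "e' \<le> \<eta>'" using R \<eta>' by (auto simp: e' field_simps)
qed

text \<open>In the difference of two solutions \<gamma> and \<delta> cancel, leaving a homogeneous
  solution, which \<open>bad\<close> excludes. Adding the errors costs a factor \<open>4 * R\<close>
  and the size of \<open>q - q'\<close> another \<open>R\<close>, whence the assumption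
  \<open>4 * R\<^sup>2 * \<eta>' \<le> e\<close>. For equal denominators the numerators differ by
  less than one.\<close>

lemma class'_unique:
  assumes b: "closed_ball b" "(x, y) \<in> b"
    and cl: "in_class' R \<gamma> \<delta> \<eta>' e' b p r q" and cl': "in_class' R \<gamma> \<delta> \<eta>' e' b p' r' q'"
    and near: "near e' \<gamma> \<delta> x y p r q"
  shows "p = p' \<and> r = r' \<and> q = q'"
proof -
  define \<rho> where "\<rho> = radius b"
  have \<rho>: "\<rho> > 0" using closed_ball_eq_cball[OF b(1)] by (simp add: \<rho>_def)
  have q: "1 \<le> q" "1 \<le> q'" using cl cl' by (auto simp: in_class'_def)
  have ratio: "real_of_int s \<le> R * t"
    if "1 \<le> s" "1 \<le> t" "\<rho> * s powr (1 + w_max) < \<eta>' * R" "\<eta>' \<le> \<rho> * t powr (1 + w_max)" for s t :: int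
  proof -
    have "\<rho> * s powr (1 + w_max) \<le> \<eta>' * R" using that by simp
    also have "\<dots> \<le> \<rho> * t powr (1 + w_max) * R" using that R by (intro mult_right_mono) auto
    finally have "\<rho> * s powr (1 + w_max) \<le> \<rho> * (R * t powr (1 + w_max))" by (simp add: mult_ac)
    then have "s powr (1 + w_max) \<le> R * t powr (1 + w_max)" by (rule mult_left_le_imp_le) (rule \<rho>)
    then show ?thesis using powr_le_mult_powr_imp_le[of s t R "1 + w_max"] that R w_bounds(5) by simp
  qed
  have qq: "q \<le> R * q'" "q' \<le> R * q"
    using ratio[of q q'] ratio[of q' q] q cl cl' by (auto simp: in_class'_def \<rho>_def)
  obtain x' y' where xy': "(x', y') \<in> b" "near e' \<gamma> \<delta> x' y' p' r' q'"
    using cl' by (auto simp: in_class'_def)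
  have near': "\<bar>q' * x - p' - \<gamma>\<bar> \<le> e' * q' powr (- i) + 2 * \<rho> * q'"
    "\<bar>q' * y - r' - \<delta>\<bar> \<le> e' * q' powr (- j) + 2 * \<rho> * q'"
    using near_transfer[OF xy'(2) closed_ball_coordinates[OF b xy'(1)] q(2)] by (simp_all add: \<rho>_def)
  have "\<rho> * q' powr (1 + w_max) \<le> \<eta>' * R" using cl' by (simp add: in_class'_def \<rho>_def)
  then have \<rho>q: "\<rho> * q' \<le> \<eta>' * R * q' powr (- w_max)"
    using q by (simp add: powr_add powr_minus field_simps)
  define Q where "Q = real_of_int (min q q')"
  have Q: "1 \<le> Q" "Q \<le> q" "Q \<le> q'" "q \<le> R * Q" "q' \<le> R * Q"
  proof -
    have "1 * real_of_int q \<le> R * q" "1 * real_of_int q' \<le> R * q'" using q R by (intro mult_right_mono; simp)+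
    then show "1 \<le> Q" "Q \<le> q" "Q \<le> q'" "q \<le> R * Q" "q' \<le> R * Q"
      using q qq by (auto simp: Q_def min_def)
  qed
  \<comment> \<open>The displacement \<open>2 * \<rho> * q'\<close> within the ball is at most
    \<open>2 * R * \<eta>' * q' powr (- w_max)\<close> by the upper end of the class, so it fits any
    exponent up to \<open>w_max\<close>.\<close>
  have *: "\<bar>(q - q') * u - (a - a')\<bar> \<le> 4 * R * \<eta>' * Q powr (- t)"
    if t: "0 < t" "t \<le> w_max" and u: "\<bar>q * u - a - w\<bar> \<le> e' * q powr (- t)"
      "\<bar>q' * u - a' - w\<bar> \<le> e' * q' powr (- t) + 2 * \<rho> * q'" for u w t :: real and a a' :: int
  proof -
    have "q' powr (- w_max) \<le> q' powr (- t)" using q t by (intro powr_mono) auto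
    then have "\<eta>' * R * q' powr (- w_max) \<le> \<eta>' * R * q' powr (- t)"
      using \<eta>' R by (intro mult_left_mono) auto
    then have 1: "2 * \<rho> * q' \<le> 2 * R * \<eta>' * q' powr (- t)" using \<rho>q by (simp add: mult_ac)
    have mono: "q powr (- t) \<le> Q powr (- t)" "q' powr (- t) \<le> Q powr (- t)"
      using Q t by (auto intro!: powr_mono2')
    have "e' * q powr (- t) \<le> \<eta>' * Q powr (- t)" "e' * q' powr (- t) \<le> \<eta>' * Q powr (- t)"
      using mono e'_bounds \<eta>' by (auto intro!: mult_mono)
    moreover have "\<eta>' * Q powr (- t) \<le> R * \<eta>' * Q powr (- t)"
      using R \<eta>' by (intro mult_right_mono) auto
    moreover have "2 * R * \<eta>' * q' powr (- t) \<le> 2 * R * \<eta>' * Q powr (- t)"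
      using mono R \<eta>' by (intro mult_left_mono) auto
    moreover have "(q - q') * u - (a - a') = (q * u - a - w) - (q' * u - a' - w)"
      by (simp add: algebra_simps)
    ultimately show ?thesis using 1 u by linarith
  qed
  have diff: "\<bar>(q - q') * x - (p - p')\<bar> \<le> 4 * R * \<eta>' * Q powr (- i)"
    "\<bar>(q - q') * y - (r - r')\<bar> \<le> 4 * R * \<eta>' * Q powr (- j)"
    using *[of i x p \<gamma> p'] *[of j y r \<delta> r'] i_pos j_pos near near' by (simp_all add: near_def)
  have "q = q'"
  proof (rule ccontr)
    assume "q \<noteq> q'"
    define d where "d = real_of_int \<bar>q - q'\<bar>"
    have d: "0 < d" "d \<le> R * Q" using \<open>q \<noteq> q'\<close> Q q by (auto simp: d_def)
    have **: "4 * R * \<eta>' * Q powr (- t) \<le> e * d powr (- t)" if "0 < t" "t \<le> 1" for t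
    proof -
      have "d powr t \<le> R * Q powr t" using d Q R that by (intro powr_le_mult_powr) auto
      then have "4 * R * \<eta>' * d powr t \<le> 4 * R * \<eta>' * (R * Q powr t)"
        using R \<eta>' by (intro mult_left_mono) auto
      also have "\<dots> = 4 * R\<^sup>2 * \<eta>' * Q powr t" by (simp add: power2_eq_square)
      also have "\<dots> \<le> e * Q powr t" using \<eta>' by (intro mult_right_mono) auto
      finally show ?thesis using d Q by (simp add: powr_minus field_simps)
    qed
    have bd: "\<bar>(q - q') * x - (p - p')\<bar> \<le> e * d powr (- i)" "\<bar>(q - q') * y - (r - r')\<bar> \<le> e * d powr (- j)"
      using diff **[of i] **[of j] i_pos j_pos sum_eq_1 by auto
    have "near e 0 0 x y (sgn (q - q') * (p - p')) (sgn (q - q') * (r - r')) \<bar>q - q'\<bar>"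
    proof (cases "q > q'")
      case True
      then show ?thesis using bd by (simp add: near_def d_def)
    next
      case False
      then have "sgn (q - q') = - 1" "\<bar>q - q'\<bar> = q' - q" using \<open>q \<noteq> q'\<close> by auto
      moreover have "\<bar>(q' - q) * x - (p' - p)\<bar> = \<bar>(q - q') * x - (p - p')\<bar>"
        "\<bar>(q' - q) * y - (r' - r)\<bar> = \<bar>(q - q') * y - (r - r')\<bar>"
        by (simp_all add: algebra_simps abs_minus_commute)
      ultimately show ?thesis using bd unfolding near_def d_def by simp
    qed
    then show False using bad[of "\<bar>q - q'\<bar>"] \<open>q \<noteq> q'\<close> by simp
  qed
  have "4 * R * \<eta>' * Q powr (- t) < 1" if "0 < t" for t
  proof -
    have "Q powr (- t) \<le> Q powr 0" using Q that by (intro powr_mono) auto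
    then have "4 * R * \<eta>' * Q powr (- t) \<le> 4 * R * \<eta>' * 1"
      using Q R \<eta>' by (intro mult_left_mono) auto
    moreover have "R * (4 * R * \<eta>') \<le> 1" using \<eta>'(2) e(3) by (simp add: power2_eq_square mult_ac)
    then have "4 * R * \<eta>' \<le> 1 / R" using R by (simp add: field_simps)
    moreover have "1 / R < 1" using R by simp
    ultimately show ?thesis by linarith
  qed
  then have "\<bar>real_of_int (p - p')\<bar> < 1" "\<bar>real_of_int (r - r')\<bar> < 1"
    using diff i_pos j_pos \<open>q = q'\<close> by (auto simp: abs_minus_commute intro: le_less_trans)
  then show ?thesis using \<open>q = q'\<close> by linarith
qed

text \<open>Across the strip only the coordinate of the larger weight counts, and its error divided
  by \<open>q\<close> is at most \<open>e' / q powr (1 + w_max)\<close>, hence at most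
  \<open>radius b / R ^ 22\<close>.\<close>

lemma class'_in_strip:
  assumes b: "closed_ball b"
    and cl: "in_class' R \<gamma> \<delta> \<eta>' e' b p r q" and near: "near e' \<gamma> \<delta> x y p r q"
  shows "(x, y) \<in> strip (axis_line \<gamma> \<delta> p r q) (radius b / R ^ 20)"
proof -
  have \<rho>: "radius b > 0" using closed_ball_eq_cball[OF b(1)] by simp
  have q: "1 \<le> q" using cl by (auto simp: in_class'_def)
  have *: "\<bar>u - (a + w) / q\<bar> < radius b / R ^ 20"
    if "\<bar>q * u - a - w\<bar> \<le> e' * q powr (- w_max)" for u w :: real and a :: int
  proof -
    have "u - (a + w) / q = (q * u - a - w) / q" using q by (simp add: field_simps)
    then have "\<bar>u - (a + w) / q\<bar> = \<bar>q * u - a - w\<bar> / q" using q by simp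
    also have "\<dots> \<le> e' * q powr (- w_max) / q" using that q by (intro divide_right_mono) auto
    also have "\<dots> = (\<eta>' / q powr (1 + w_max)) / R ^ 22"
      using q by (simp add: e' powr_add powr_minus field_simps)
    also have "\<dots> \<le> radius b / R ^ 22"
      using cl q R by (intro divide_right_mono) (auto simp: in_class'_def field_simps)
    also have "\<dots> < radius b / R ^ 20"
      using \<rho> R by (intro divide_strict_left_mono power_strict_increasing) auto
    finally show ?thesis .
  qed
  show ?thesis
  proof (cases "j \<le> i")
    case True
    then have "\<bar>x - (p + \<gamma>) / q\<bar> < radius b / R ^ 20"
      using near by (intro *) (simp add: near_def max_def)
    then show ?thesis using True unfolding strip_def axis_line_def by simp
  next
    case False
    then have "\<bar>y - (r + \<delta>) / q\<bar> < radius b / R ^ 20"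
      using near by (intro *) (simp add: near_def max_def)
    then show ?thesis using False unfolding strip_def axis_line_def by simp
  qed
qed

lemma ex_class':
  assumes "near e' \<gamma> \<delta> x y p r q" "1 \<le> q"
    and b: "\<And>n. (x, y) \<in> b n" "\<And>n. radius (b n) = radius (b 0) / R ^ n" "\<eta>' \<le> radius (b 0)"
  shows "\<exists>n. in_class' R \<gamma> \<delta> \<eta>' e' (b n) p r q"
proof -
  define H where "H = q powr (1 + w_max)"
  have "1 \<le> H" unfolding H_def using assms(2) w_bounds(5) by (intro ge_one_powr_ge_zero) auto
  then have "\<eta>' * 1 \<le> radius (b 0) * H" using b(3) \<eta>' by (intro mult_mono) auto
  then have s: "1 \<le> radius (b 0) * H / \<eta>'" using \<eta>' by simp
  obtain n where n: "R ^ n \<le> radius (b 0) * H / \<eta>'" "radius (b 0) * H / \<eta>' < R ^ (n + 1)"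
    using ex_power_bracket[OF _ s, of R] R by auto
  have "in_class' R \<gamma> \<delta> \<eta>' e' (b n) p r q"
    unfolding in_class'_def H_def[symmetric]
  proof (intro conjI)
    show "\<exists>x y. (x, y) \<in> b n \<and> near e' \<gamma> \<delta> x y p r q" using b(1) assms(1) by blast
    show "\<eta>' \<le> radius (b n) * H"
      using n(1) \<eta>' R unfolding b(2)[of n] by (simp add: field_simps)
    show "radius (b n) * H < \<eta>' * R"
      using n(2) \<eta>' R unfolding b(2)[of n] by (simp add: field_simps)
  qed fact
  then show ?thesis by blast
qed

text \<open>The class of a near solution has no other member, so the strip avoided for this class is
  the one containing its box.\<close>

lemma inhomogeneous_bad:
  assumes b: "\<And>n. closed_ball (b n)" "\<And>n. (x, y) \<in> b n" "\<And>n. radius (b n) = radius (b 0) / R ^ n"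
      "\<eta>' \<le> radius (b 0)"
    and avoid: "\<And>n. \<exists>p r q. in_class' R \<gamma> \<delta> \<eta>' e' (b n) p r q \<Longrightarrow>
      \<exists>p r q. in_class' R \<gamma> \<delta> \<eta>' e' (b n) p r q \<and> (x, y) \<notin> strip (axis_line \<gamma> \<delta> p r q) (radius (b n) / R ^ 20)"
    and "1 \<le> q"
  shows "\<not> near e' \<gamma> \<delta> x y p r q"
proof
  assume near: "near e' \<gamma> \<delta> x y p r q"
  obtain n where cl: "in_class' R \<gamma> \<delta> \<eta>' e' (b n) p r q"
    using ex_class'[OF near \<open>1 \<le> q\<close> b(2,3,4)] by blast
  then obtain p' r' q' where cl': "in_class' R \<gamma> \<delta> \<eta>' e' (b n) p' r' q'"
      "(x, y) \<notin> strip (axis_line \<gamma> \<delta> p' r' q') (radius (b n) / R ^ 20)"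
    using avoid by blast
  have "p = p' \<and> r = r' \<and> q = q'" by (rule class'_unique[OF b(1,2) cl cl'(1) near])
  then show False using class'_in_strip[OF b(1) cl near] cl'(2) by blast
qed

end

end

section \<open>Badly approximable points and the winning strategy\<close>

lemma dist_nearest_int_attained: "\<exists>p::int. dist_nearest_int t = \<bar>t - p\<bar>"
proof -
  have "closed (\<int> :: real set)" "(\<int> :: real set) \<noteq> {}" by (auto intro: Ints_0)
  then obtain z :: real where "z \<in> \<int>" "infdist t \<int> = dist t z" using infdist_attains_inf by metis
  then show ?thesis unfolding dist_nearest_int_def by (auto simp: Ints_def dist_real_def)
qed

text \<open>Raising \<open>e * q powr (- i)\<close> to the power \<open>1 / i\<close> gives
  \<open>e powr (1 / i) / q\<close>, and similarly for \<open>j\<close>; the smaller of the two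
  constants serves both coordinates.\<close>

lemma (in weights) Bad_if_not_near:
  assumes "0 < e" "\<And>p r q. 1 \<le> q \<Longrightarrow> \<not> near e \<gamma> \<delta> x y p r q"
  shows "(x, y) \<in> Bad (\<gamma>, \<delta>) i j"
proof -
  define c where "c = min (e powr (1 / i)) (e powr (1 / j))"
  have "c > 0" using assms(1) by (simp add: c_def)
  have "c * inverse (real q) < max (dist_nearest_int (real q * x - \<gamma>) powr (1 / i))
      (dist_nearest_int (real q * y - \<delta>) powr (1 / j))" if "q \<ge> 1" for q :: nat
  proof -
    obtain p r :: int where pr: "dist_nearest_int (real q * x - \<gamma>) = \<bar>real q * x - \<gamma> - p\<bar>"
        "dist_nearest_int (real q * y - \<delta>) = \<bar>real q * y - \<delta> - r\<bar>"
      using dist_nearest_int_attained by metis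
    have big: "c * inverse (real q) < d powr (1 / t)"
      if "e * real q powr (- t) < d" "t > 0" "c \<le> e powr (1 / t)" for d t
    proof -
      have "c * inverse (real q) \<le> e powr (1 / t) * inverse (real q)"
        using that by (intro mult_right_mono) auto
      also have "\<dots> = (e * real q powr (- t)) powr (1 / t)"
        using assms(1) \<open>q \<ge> 1\<close> that(2) powr_minus[of "real q" 1] by (simp add: powr_mult powr_powr)
      also have "\<dots> < d powr (1 / t)"
        using that assms(1) by (intro powr_less_mono2) auto
      finally show ?thesis .
    qed
    have "\<not> near e \<gamma> \<delta> x y p r (int q)" using assms(2) that by simp
    then have "e * real q powr (- i) < dist_nearest_int (real q * x - \<gamma>) \<or>
        e * real q powr (- j) < dist_nearest_int (real q * y - \<delta>)"
      unfolding near_def pr by (auto simp: algebra_simps)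
    then show ?thesis
      using big[of i] big[of j] i_pos j_pos by (auto simp: c_def less_max_iff_disj)
  qed
  then show ?thesis using \<open>c > 0\<close> by (auto simp: Bad_def)
qed

theorem theorem3:
  fixes i j :: real and \<theta> :: "real \<times> real"
  assumes "0 < i" "i < 1" "0 < j" "j < 1" "i + j = 1"
  shows "alpha_winning (inverse (30 * sqrt 2)) (Bad \<theta> i j)"
  unfolding alpha_winning_def
proof (intro allI impI)
  fix \<beta> :: real assume \<beta>: "0 < \<beta> \<and> \<beta> < 1"
  interpret weights i j using assms by unfold_locales
  obtain \<gamma> \<delta> where \<theta>: "\<theta> = (\<gamma>, \<delta>)" by fastforce
  define \<alpha> :: real where "\<alpha> = inverse (30 * sqrt 2)"
  define R where "R = 1 / (\<alpha> * \<beta>)"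
  \<comment> \<open>As 30 * 7/5 = 42, this gives the bound on \<alpha> demanded by
    \<open>thin_strip_misses_option\<close>.\<close>
  have "7/5 \<le> sqrt 2" by (intro real_le_rsqrt) (simp add: power2_eq_square)
  then have \<alpha>: "0 < \<alpha>" "\<alpha> \<le> 1/42" by (auto simp: \<alpha>_def field_simps)
  note game = \<alpha> conjunct1[OF \<beta>] conjunct2[OF \<beta>] R_def
  have R: "R \<ge> 42" by (rule R_ge_42[OF game])
  obtain \<Lambda> :: nat where "2 / w_min \<le> \<Lambda>" using real_arch_simple by blast
  then have \<Lambda>: "2 \<le> \<Lambda> * min i j" using w_bounds(1) by (simp add: field_simps)
  \<comment> \<open>The cap by \<rho>, the radius of B's first ball, ensures that each rational
    point gets a stage: its height is at least one, so the game does not start too late for it. The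
    same holds for \<eta>'.\<close>
  define \<eta> where "\<eta> = (\<lambda>\<rho>. min \<rho> (1 / R ^ (3 * \<Lambda> + 28)))"
  define e where "e = (\<lambda>\<rho>. \<eta> \<rho> / R ^ 22)"
  define \<eta>' where "\<eta>' = (\<lambda>\<rho>. min \<rho> (e \<rho> / (4 * R\<^sup>2)))"
  define e' where "e' = (\<lambda>\<rho>. \<eta>' \<rho> / R ^ 22)"
  \<comment> \<open>Index 0 of each stage serves the inhomogeneous class and index
    \<open>Suc k\<close> the homogeneous class \<open>k\<close>.\<close>
  define hom where "hom = (\<lambda>\<rho> k b L. \<exists>p r q A B C. in_class R \<Lambda> (\<eta> \<rho>) (e \<rho>) k b p r q A B C \<and>
    L = (real_of_int A, real_of_int B, real_of_int C))"
  define inhom where "inhom = (\<lambda>\<rho> b L. \<exists>p r q. in_class' R \<gamma> \<delta> (\<eta>' \<rho>) (e' \<rho>) b p r q \<and>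
    L = axis_line \<gamma> \<delta> p r q)"
  \<comment> \<open>The constants depend on the radius of B's first ball, which is \<open>radius b * R ^ n\<close>
    when \<open>b\<close> is played at stage \<open>n\<close>.\<close>
  define S where "S = (\<lambda>n k b. case k of 0 \<Rightarrow> (SOME L. inhom (radius b * R ^ n) b L)
    | Suc k' \<Rightarrow> (SOME L. hom (radius b * R ^ n) k' b L))"
  have "\<exists>X\<in>Bad \<theta> i j. (\<Inter>n. B n) = {X}" if legal: "\<And>n. legal_B \<beta> (strategy \<alpha> R S) B n" for B
  proof -
    obtain x y where xy: "(\<Inter>n. B n) = {(x, y)}" using play_point[OF game legal] by auto
    define \<rho> where "\<rho> = radius (B 0)"
    note ball = play_closed_ball[OF game legal]
    have \<rho>: "\<rho> > 0" using closed_ball_eq_cball(2)[OF ball] by (simp add: \<rho>_def)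
    have inB: "(x, y) \<in> B n" for n using xy by blast
    note rad = play_radius[OF game legal]
    have first: "radius (B n) * R ^ n = \<rho>" for n using rad[of n] R by (simp add: \<rho>_def)
    have avoid: "(x, y) \<notin> strip (S n k (B n)) (radius (B n) / R ^ (k + 20))" if "k \<le> Suc n" for n k
      using play_avoids[OF game legal _ that] xy by blast
    have scale: "0 < \<eta> \<rho>" "\<eta> \<rho> \<le> 1 / R ^ (3 * \<Lambda> + 28)" "\<eta> \<rho> \<le> \<rho>" using \<rho> R by (auto simp: \<eta>_def)
    interpret scales i j R "\<eta> \<rho>" "e \<rho>" \<Lambda>
      using R \<Lambda> scale by unfold_locales (auto simp: e_def)
    have \<eta>': "0 < \<eta>' \<rho>" "\<eta>' \<rho> \<le> \<rho>" using \<rho> R e by (auto simp: \<eta>'_def)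
    have "\<eta>' \<rho> \<le> e \<rho> / (4 * R\<^sup>2)" by (simp add: \<eta>'_def)
    then have \<eta>'_le: "4 * R\<^sup>2 * \<eta>' \<rho> \<le> e \<rho>" using R by (simp add: field_simps)
    have bad0: "\<not> near (e \<rho>) 0 0 x y p r q" if "1 \<le> q" for p r q
    proof (rule homogeneous_bad[of B, OF ball inB rad _ _ that])
      show "\<eta> \<rho> \<le> radius (B 0)" using scale(3) by (simp add: \<rho>_def)
      fix n k assume kn: "k \<le> n"
        and "\<exists>p r q A B' C. in_class R \<Lambda> (\<eta> \<rho>) (e \<rho>) k (B n) p r q A B' C"
      \<comment> \<open>In a nonempty class the choice yields the line of some member; for an empty
        class the prescribed triple is arbitrary, and avoiding it does no harm.\<close>
      then have "\<exists>L. hom \<rho> k (B n) L" unfolding hom_def by blast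
      then have "hom \<rho> k (B n) (S n (Suc k) (B n))"
        unfolding S_def first nat.case by (rule someI_ex)
      then show "\<exists>p r q A B' C. in_class R \<Lambda> (\<eta> \<rho>) (e \<rho>) k (B n) p r q A B' C \<and>
          (x, y) \<notin> strip (real_of_int A, real_of_int B', real_of_int C) (radius (B n) / R ^ (Suc k + 20))"
        using avoid[of "Suc k" n] kn unfolding hom_def by (metis Suc_le_mono)
    qed
    have bad: "\<not> near (e' \<rho>) \<gamma> \<delta> x y p r q" if "1 \<le> q" for p r q
    proof (rule inhomogeneous_bad[where b = B, OF \<eta>'(1) \<eta>'_le _ bad0 ball inB rad _ _ that])
      show "e' \<rho> = \<eta>' \<rho> / R ^ 22" by (simp add: e'_def)
      show "\<eta>' \<rho> \<le> radius (B 0)" using \<eta>'(2) by (simp add: \<rho>_def)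
      fix n assume "\<exists>p r q. in_class' R \<gamma> \<delta> (\<eta>' \<rho>) (e' \<rho>) (B n) p r q"
      then have "\<exists>L. inhom \<rho> (B n) L" unfolding inhom_def by blast
      then have "inhom \<rho> (B n) (S n 0 (B n))"
        unfolding S_def first nat.case by (rule someI_ex)
      then show "\<exists>p r q. in_class' R \<gamma> \<delta> (\<eta>' \<rho>) (e' \<rho>) (B n) p r q \<and>
          (x, y) \<notin> strip (axis_line \<gamma> \<delta> p r q) (radius (B n) / R ^ 20)"
        using avoid[of 0 n] unfolding inhom_def by (metis add_0 le0)
    qed
    have "0 < e' \<rho>" using \<eta>' R by (simp add: e'_def)
    then have "(x, y) \<in> Bad \<theta> i j" unfolding \<theta> using bad by (rule Bad_if_not_near)
    then show ?thesis using xy by blast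
  qed
  \<comment> \<open>A's answer is legal as soon as \<open>B n\<close> is a ball, so unfinished plays
    are covered as well.\<close>
  moreover have "legal_A \<alpha> (strategy \<alpha> R S) B n" if "\<And>k. k \<le> n \<Longrightarrow> legal_B \<beta> (strategy \<alpha> R S) B k" for B n
  proof (rule legal_A_strategy[OF game])
    show "closed_ball (B n)" using that[of n] by (cases n) auto
  qed
  ultimately show "schmidt_winning (inverse (30 * sqrt 2)) \<beta> (Bad \<theta> i j)"
    unfolding schmidt_winning_def \<alpha>_def[symmetric] by (intro exI[of _ "strategy \<alpha> R S"]) blast
qed

end
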